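(* Let $\Omega$ be a causally convex domain in $\mathbf{R}^{1,n}$ and let $\varepsilon>0$. Assume that $\partial_c^+\Omega$ and $\partial_c^-\Omega$ are $\varepsilon$-stably acausal. Then $$\frac{\varepsilon}{\sqrt{(2+\varepsilon)^2+\varepsilon^2}}\,\mathrm{k}_\Omega\le\delta_\Omega\le 2\sqrt2\,\mathrm{k}_\Omega .$$
   Context: Minkowski space: $\mathbf{R}^{1,n}$ ($n\ge 1$) is $\mathbf{R}\times\mathbf{R}^n$ with coordinates $(t,p)$, flat metric $\mathbf{b}=-dt^2+dp_1^2+\dots+dp_n^2$ and time orientation $\partial_t$. A nonzero vector $v$ is lightlike if $\mathbf{b}(v,v)=0$, causal if $\mathbf{b}(v,v)\le 0$; a causal curve is a piecewise smooth curve with future causal (or past causal) velocity. Let $h=dt^2+dp_1^2+\dots+dp_n^2$ be the Euclidean metric, with distance $d_h$. A domain is a nonempty, connected, proper open subset of $\mathbf{R}^{1,n}$. A domain $\Omega$ is causally convex if every causal curve of $\mathbf{R}^{1,n}$ with endpoints in $\Omega$ is contained in $\Omega$. Quasi-hyperbolic distance: $\mathrm{k}_\Omega$ is the Riemannian distance on $\Omega$ of the (continuous) metric $\mathfrak{h}_\Omega=d_h(x,\partial\Omega)^{-2}h$. Markowitz pseudodistance: let $I=(-1,1)$ and $\rho_I(s,t)=\left|\ln\frac{(s-1)(t+1)}{(s+1)(t-1)}\right|$. For a domain $\Omega$, a projectively parametrized lightlike geodesic of $\Omega$ is a curve $\gamma:I\to\Omega$, $\gamma(s)=x+h(s)v$,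 with $v$ lightlike and $h$ here a (nonconstant) real homography without pole in $I$. Then $\delta_\Omega(x,y)=\inf\sum_{k=1}^m\rho_I(s_k,t_k)$, the infimum being over all finite families of such geodesics $\gamma_1,\dots,\gamma_m$ and points $s_k,t_k\in I$ with $\gamma_1(s_1)=x$, $\gamma_m(t_m)=y$, $\gamma_k(t_k)=\gamma_{k+1}(s_{k+1})$. Causal boundary: a causally convex domain can be written $\Omega=\{(t,p)\in\mathbf{R}\times U : f_-(p)<t<f_+(p)\}$ with $U\subset\mathbf{R}^n$ open and $f_\pm:\overline U\to\overline{\mathbf{R}}$ 1-Lipschitz, $f_-<f_+$ on $U$, $f_-=f_+$ on $\partial U$. $\partial_c^+\Omega$ (resp. $\partial_c^-\Omega$) is the graph $\{(f_\pm(p),p)\}$ of $f_+$ (resp. $f_-$), empty if that function is infinite. Stable acausality: let $\mathbf{b}_\varepsilon=-(1+\varepsilon)^2dt^2+dp_1^2+\dots+dp_n^2$. A subset of $\mathbf{R}^{1,n}$ is $\varepsilon$-stably acausal if no two distinct points of it are causally related for $\mathbf{b}_\varepsilon$. *)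

theory Defs
  imports "HOL-Analysis.Analysis"
begin

text \<open>
  Minkowski space of dimension 1 + n is the product \<open>real \<times> real ^ 'n\<close>, a point being \<open>(t, p)\<close>.
  The library norm and distance of this product type are those of the Euclidean metric
  \<open>dt\<^sup>2 + dp\<^sub>1\<^sup>2 + \<dots> + dp\<^sub>n\<^sup>2\<close>.
\<close>

type_synonym 'n spacetime = "real \<times> (real ^ 'n)"

text \<open>The metric \<open>b\<^sub>\<epsilon>\<close>; the Minkowski metric is the case \<open>\<epsilon> = 0\<close>.\<close>

definition lorentz_form :: "real \<Rightarrow> 'n::finite spacetime \<Rightarrow> 'n spacetime \<Rightarrow> real" where
  "lorentz_form \<epsilon> v w = - (1 + \<epsilon>)\<^sup>2 * (fst v * fst w) + snd v \<bullet> snd w"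

definition lightlike :: "'n::finite spacetime \<Rightarrow> bool" where
  "lightlike v \<longleftrightarrow> v \<noteq> 0 \<and> lorentz_form 0 v v = 0"

definition causal :: "real \<Rightarrow> 'n::finite spacetime \<Rightarrow> bool" where
  "causal \<epsilon> v \<longleftrightarrow> v \<noteq> 0 \<and> lorentz_form \<epsilon> v v \<le> 0"

definition future_causal :: "real \<Rightarrow> 'n::finite spacetime \<Rightarrow> bool" where
  "future_causal \<epsilon> v \<longleftrightarrow> causal \<epsilon> v \<and> fst v > 0"

definition past_causal :: "real \<Rightarrow> 'n::finite spacetime \<Rightarrow> bool" where
  "past_causal \<epsilon> v \<longleftrightarrow> causal \<epsilon> v \<and> fst v < 0"

text \<open>Derivatives of all orders on the closed interval, one-sided at its end points.\<close>

definition smooth_curve_on :: "real \<Rightarrow> real \<Rightarrow> (real \<Rightarrow> 'a::real_normed_vector) \<Rightarrow> bool" where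
  "smooth_curve_on a b \<gamma> \<longleftrightarrow>
     (\<exists>D :: nat \<Rightarrow> real \<Rightarrow> 'a. D 0 = \<gamma> \<and>
        (\<forall>k. \<forall>t\<in>{a..b}. (D k has_vector_derivative D (Suc k) t) (at t within {a..b})))"

text \<open>
  Curves are parametrized by the unit interval. The subdivision \<open>\<tau>\<^sub>0 < \<dots> < \<tau>\<^sub>m\<close> consists of
  closed pieces, so velocities are bounded (unlike for the library's
  \<open>piecewise_C1_differentiable_on\<close>) and both one-sided velocities exist at break points.
\<close>

definition smooth_subdivision :: "nat \<Rightarrow> (nat \<Rightarrow> real) \<Rightarrow> (real \<Rightarrow> 'a::real_normed_vector) \<Rightarrow> bool" where
  "smooth_subdivision m \<tau> \<gamma> \<longleftrightarrow>
     \<tau> 0 = 0 \<and> \<tau> m = 1 \<and>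
     (\<forall>i<m. \<tau> i < \<tau> (Suc i) \<and> smooth_curve_on (\<tau> i) (\<tau> (Suc i)) \<gamma>)"

definition piecewise_smooth_curve :: "(real \<Rightarrow> 'a::real_normed_vector) \<Rightarrow> bool" where
  "piecewise_smooth_curve \<gamma> \<longleftrightarrow> (\<exists>m \<tau>. smooth_subdivision m \<tau> \<gamma>)"

definition causal_curve :: "real \<Rightarrow> (real \<Rightarrow> 'n::finite spacetime) \<Rightarrow> bool" where
  "causal_curve \<epsilon> \<gamma> \<longleftrightarrow>
     (\<exists>m \<tau>. smooth_subdivision m \<tau> \<gamma> \<and>
        ((\<forall>i<m. \<forall>t\<in>{\<tau> i..\<tau> (Suc i)}.
            future_causal \<epsilon> (vector_derivative \<gamma> (at t within {\<tau> i..\<tau> (Suc i)}))) \<or>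
         (\<forall>i<m. \<forall>t\<in>{\<tau> i..\<tau> (Suc i)}.
            past_causal \<epsilon> (vector_derivative \<gamma> (at t within {\<tau> i..\<tau> (Suc i)})))))"

definition domain :: "'n::finite spacetime set \<Rightarrow> bool" where
  "domain \<Omega> \<longleftrightarrow> open \<Omega> \<and> connected \<Omega> \<and> \<Omega> \<noteq> {} \<and> \<Omega> \<noteq> UNIV"

definition causally_convex :: "'n::finite spacetime set \<Rightarrow> bool" where
  "causally_convex \<Omega> \<longleftrightarrow>
     (\<forall>\<gamma>. causal_curve 0 \<gamma> \<and> \<gamma> 0 \<in> \<Omega> \<and> \<gamma> 1 \<in> \<Omega> \<longrightarrow> \<gamma> ` {0..1} \<subseteq> \<Omega>)"

text \<open>
  In the two distances below the infimum is taken in \<open>ennreal\<close>, so that it would be \<open>\<infinity>\<close>, and not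
  an unspecified real, over an empty family.
\<close>

definition quasihyperbolic_length :: "'n::finite spacetime set \<Rightarrow> (real \<Rightarrow> 'n spacetime) \<Rightarrow> real" where
  "quasihyperbolic_length \<Omega> \<gamma> =
     integral {0..1} (\<lambda>t. norm (vector_derivative \<gamma> (at t within {0..1})) / infdist (\<gamma> t) (frontier \<Omega>))"

definition quasihyperbolic_dist ::
    "'n::finite spacetime set \<Rightarrow> 'n spacetime \<Rightarrow> 'n spacetime \<Rightarrow> ennreal" where
  "quasihyperbolic_dist \<Omega> x y =
     (INF \<gamma> \<in> {\<gamma>. piecewise_smooth_curve \<gamma> \<and> \<gamma> ` {0..1} \<subseteq> \<Omega> \<and> \<gamma> 0 = x \<and> \<gamma> 1 = y}.
        ennreal (quasihyperbolic_length \<Omega> \<gamma>))"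

definition rho_I :: "real \<Rightarrow> real \<Rightarrow> real" where
  "rho_I s t = \<bar>ln (((s - 1) * (t + 1)) / ((s + 1) * (t - 1)))\<bar>"

definition projective_lightlike_geodesic ::
    "'n::finite spacetime set \<Rightarrow> (real \<Rightarrow> 'n spacetime) \<Rightarrow> bool" where
  "projective_lightlike_geodesic \<Omega> \<gamma> \<longleftrightarrow>
     (\<exists>x v a b c d. lightlike v \<and> a * d - b * c \<noteq> 0 \<and>
        (\<forall>s\<in>{-1<..<1}. c * s + d \<noteq> 0 \<and>
           \<gamma> s = x + ((a * s + b) / (c * s + d)) *\<^sub>R v \<and> \<gamma> s \<in> \<Omega>))"

definition markowitz_chain ::
    "'n::finite spacetime set \<Rightarrow> 'n spacetime \<Rightarrow> 'n spacetime \<Rightarrow>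
     nat \<Rightarrow> (nat \<Rightarrow> real \<Rightarrow> 'n spacetime) \<Rightarrow> (nat \<Rightarrow> real) \<Rightarrow> (nat \<Rightarrow> real) \<Rightarrow> bool" where
  "markowitz_chain \<Omega> x y m \<gamma> s t \<longleftrightarrow>
     1 \<le> m \<and>
     (\<forall>k\<in>{1..m}. projective_lightlike_geodesic \<Omega> (\<gamma> k) \<and> s k \<in> {-1<..<1} \<and> t k \<in> {-1<..<1}) \<and>
     \<gamma> 1 (s 1) = x \<and> \<gamma> m (t m) = y \<and>
     (\<forall>k\<in>{1..<m}. \<gamma> k (t k) = \<gamma> (k + 1) (s (k + 1)))"

definition markowitz_dist ::
    "'n::finite spacetime set \<Rightarrow> 'n spacetime \<Rightarrow> 'n spacetime \<Rightarrow> ennreal" where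
  "markowitz_dist \<Omega> x y =
     Inf {ennreal (\<Sum>k=1..m. rho_I (s k) (t k)) | m \<gamma> s t. markowitz_chain \<Omega> x y m \<gamma> s t}"

text \<open>
  By the arithmetic of \<open>ereal\<close>, the inequality below says that \<open>f\<close> is either finite and 1-Lipschitz
  on \<open>S\<close>, or identically \<open>\<infinity>\<close>, or identically \<open>- \<infinity>\<close>.
\<close>

definition lipschitz1_ereal_on :: "(real ^ 'n::finite) set \<Rightarrow> (real ^ 'n \<Rightarrow> ereal) \<Rightarrow> bool" where
  "lipschitz1_ereal_on S f \<longleftrightarrow> (\<forall>p\<in>S. \<forall>q\<in>S. f p \<le> f q + ereal (dist p q))"

definition graph_representation ::
    "'n::finite spacetime set \<Rightarrow> (real ^ 'n) set \<Rightarrow> (real ^ 'n \<Rightarrow> ereal) \<Rightarrow> (real ^ 'n \<Rightarrow> ereal) \<Rightarrow> bool" where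
  "graph_representation \<Omega> U f\<^sub>m f\<^sub>p \<longleftrightarrow>
     open U \<and> lipschitz1_ereal_on (closure U) f\<^sub>m \<and> lipschitz1_ereal_on (closure U) f\<^sub>p \<and>
     (\<forall>p\<in>U. f\<^sub>m p < f\<^sub>p p) \<and> (\<forall>p\<in>frontier U. f\<^sub>m p = f\<^sub>p p) \<and>
     \<Omega> = {(t, p). p \<in> U \<and> f\<^sub>m p < ereal t \<and> ereal t < f\<^sub>p p}"

text \<open>
  \<open>U\<close> and the restrictions of \<open>f\<^sub>m\<close>, \<open>f\<^sub>p\<close> to its closure are determined by a nonempty \<open>\<Omega>\<close>, so each
  union over representations is the single graph over \<open>closure U\<close>; it is empty for an infinite function.
\<close>

definition future_causal_boundary :: "'n::finite spacetime set \<Rightarrow> 'n spacetime set" where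
  "future_causal_boundary \<Omega> =
     {(t, p). \<exists>U f\<^sub>m f\<^sub>p. graph_representation \<Omega> U f\<^sub>m f\<^sub>p \<and> p \<in> closure U \<and> f\<^sub>p p = ereal t}"

definition past_causal_boundary :: "'n::finite spacetime set \<Rightarrow> 'n spacetime set" where
  "past_causal_boundary \<Omega> =
     {(t, p). \<exists>U f\<^sub>m f\<^sub>p. graph_representation \<Omega> U f\<^sub>m f\<^sub>p \<and> p \<in> closure U \<and> f\<^sub>m p = ereal t}"

definition causally_related :: "real \<Rightarrow> 'n::finite spacetime \<Rightarrow> 'n spacetime \<Rightarrow> bool" where
  "causally_related \<epsilon> x y \<longleftrightarrow> (\<exists>\<gamma>. causal_curve \<epsilon> \<gamma> \<and> \<gamma> 0 = x \<and> \<gamma> 1 = y)"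

definition stably_acausal :: "real \<Rightarrow> 'n::finite spacetime set \<Rightarrow> bool" where
  "stably_acausal \<epsilon> A \<longleftrightarrow> (\<forall>x\<in>A. \<forall>y\<in>A. x \<noteq> y \<longrightarrow> \<not> causally_related \<epsilon> x y)"

end

theory Submission
  imports Defs
begin

text \<open>
  A causally convex domain lies between two 1-Lipschitz graphs. Stable acausality makes them
  Lipschitz with constant \<open>1 / (1 + \<epsilon>)\<close>, so that from a point at distance \<open>d\<close> from the boundary a
  lightlike line must leave the domain, to the future or to the past, within Euclidean length
  \<open>C d\<close>, where \<open>C = sqrt ((2 + \<epsilon>)\<^sup>2 + \<epsilon>\<^sup>2) / \<epsilon>\<close>. The speed of a projectively parametrized geodesic,
  measured against the distances at which it exits, is at most the density \<open>2 / (1 - s\<^sup>2)\<close> of the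
  metric of the interval; integration along a chain gives the lower bound.

  Conversely, the ball of radius \<open>d\<close> about a point contains the lightlike segments of that length
  through it, on which the Markowitz distance is infinitesimally at most \<open>2 / d\<close> times length. A vector
  splits into two lightlike ones of total length at most \<open>sqrt 2\<close> times its own, whence \<open>2 sqrt 2\<close>.
\<close>

section \<open>Piecewise smooth curves\<close>

text \<open>Origin of C: let light climb from x by a time h and remain below the upper graph, and
  let z be a point of that graph. Slope at most 1 / (1 + \<epsilon>) against the slope 1 of light
  leaves \<epsilon> h \<le> (1 + \<epsilon>) T + P, where T and P are the distances of x and z in
  time and in space, hence \<epsilon> h \<le> sqrt ((1 + \<epsilon>)^2 + 1) d(x, z) by
  Cauchy-Schwarz. A lightlike vector is sqrt 2 times as long as its time component, and 2 ((1 +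
  \<epsilon>)^2 + 1) = (2 + \<epsilon>)^2 + \<epsilon>^2. The obstacle: a boundary point controls
  light in one time direction only, that of the graph on which it lies. So d bounds just the smaller
  of the distances \<tau>1, \<tau>2 from a point of a geodesic to its two ends. This is enough,
  because the speed of a projective parametrization onto the segment between these ends, divided by
  2 / (1 - s^2), is \<tau>1 \<tau>2 / (\<tau>1 + \<tau>2), which is at most either of them.\<close>

lemma smooth_curve_on_cong:
  assumes "smooth_curve_on a b \<gamma>" and "\<And>t. t \<in> {a..b} \<Longrightarrow> \<gamma>' t = \<gamma> t"
  shows "smooth_curve_on a b \<gamma>'"
proof -
  obtain D where D: "D 0 = \<gamma>"
    "\<And>k t. t \<in> {a..b} \<Longrightarrow> (D k has_vector_derivative D (Suc k) t) (at t within {a..b})"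
    using assms(1) unfolding smooth_curve_on_def by blast
  \<comment> \<open>\<open>smooth_curve_on\<close> wants \<open>D 0\<close> to be the curve itself,
    off the interval as well; so entry 0 of the sequence is exchanged and only its derivative has to
    be transferred.\<close>
  have "(D(0 := \<gamma>')) 0 = \<gamma>'" by simp
  moreover have "((D(0 := \<gamma>')) k has_vector_derivative (D(0 := \<gamma>')) (Suc k) t) (at t within {a..b})"
    if "t \<in> {a..b}" for k t
  proof (cases k)
    case 0
    then show ?thesis
      using has_vector_derivative_transform[OF that, of \<gamma>' \<gamma>] assms(2) D(2)[OF that, of 0] D(1) by simp
  next
    case (Suc l)
    then show ?thesis using D(2)[OF that, of k] by simp
  qed
  ultimately show ?thesis unfolding smooth_curve_on_def by blast
qed

lemma smooth_curve_on_affine: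
  fixes \<gamma> :: "real \<Rightarrow> 'a::real_normed_vector"
  assumes "smooth_curve_on a b \<gamma>" and "\<And>t. t \<in> {a'..b'} \<Longrightarrow> c * t + e \<in> {a..b}"
  shows "smooth_curve_on a' b' (\<lambda>t. \<gamma> (c * t + e))"
proof -
  obtain D where D: "D 0 = \<gamma>"
    "\<And>k t. t \<in> {a..b} \<Longrightarrow> (D k has_vector_derivative D (Suc k) t) (at t within {a..b})"
    using assms(1) unfolding smooth_curve_on_def by blast
  define E where "E = (\<lambda>k t. c ^ k *\<^sub>R D k (c * t + e))"
  have "E 0 = (\<lambda>t. \<gamma> (c * t + e))" using D(1) by (simp add: E_def)
  moreover have "(E k has_vector_derivative E (Suc k) t) (at t within {a'..b'})"
    if "t \<in> {a'..b'}" for k t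
  proof -
    let ?f = "\<lambda>t. c * t + e"
    have 1: "(?f has_vector_derivative c) (at t within {a'..b'})"
      unfolding has_real_derivative_iff_has_vector_derivative[symmetric]
      by (auto intro!: derivative_eq_intros)
    have 2: "(D k has_vector_derivative D (Suc k) (?f t)) (at (?f t) within ?f ` {a'..b'})"
      by (rule has_vector_derivative_within_subset[OF D(2)[OF assms(2)[OF that]]]) (use assms(2) in auto)
    have "((\<lambda>t. D k (?f t)) has_vector_derivative c *\<^sub>R D (Suc k) (?f t)) (at t within {a'..b'})"
      using vector_diff_chain_within[OF 1 2] by (simp add: o_def)
    from bounded_linear.has_vector_derivative[OF bounded_linear_scaleR_right[of "c ^ k"] this]
    show ?thesis unfolding E_def by (simp add: mult.commute)
  qed
  ultimately show ?thesis unfolding smooth_curve_on_def by blast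
qed


lemma smooth_curve_on_homography:
  fixes x v :: "'a::real_normed_vector"
  assumes "\<And>t. t \<in> {l..u} \<Longrightarrow> c * t + d \<noteq> 0"
  shows "smooth_curve_on l u (\<lambda>t. x + ((a * t + b) / (c * t + d)) *\<^sub>R v)"
proof -
  \<comment> \<open>\<open>r k\<close> is the derivative of order k + 1 of the quotient: the first
    is the determinant times an inverse square, and each later one brings in a factor -(k + 2)
    c.\<close>
  define r where "r = (\<lambda>k t. fact (Suc k) * (a * d - b * c) * (- c) ^ k * inverse (c * t + d) ^ (k + 2))"
  define D where "D = (\<lambda>k t. case k of 0 \<Rightarrow> x + ((a * t + b) / (c * t + d)) *\<^sub>R v | Suc k \<Rightarrow> r k t *\<^sub>R v)"
  have "(D k has_vector_derivative D (Suc k) t) (at t within {l..u})" if t: "t \<in> {l..u}" for k t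
  proof (cases k)
    case 0
    have "((\<lambda>t. (a * t + b) / (c * t + d)) has_real_derivative r 0 t) (at t within {l..u})"
      unfolding r_def using assms[OF t]
      by (auto intro!: derivative_eq_intros simp: field_simps power2_eq_square)
    from has_vector_derivative_scaleR[OF this has_vector_derivative_const[of v]]
    have "((\<lambda>t. ((a * t + b) / (c * t + d)) *\<^sub>R v) has_vector_derivative r 0 t *\<^sub>R v) (at t within {l..u})"
      by simp
    from has_vector_derivative_add[OF has_vector_derivative_const[of x] this]
    show ?thesis using 0 by (simp add: D_def)
  next
    case (Suc j)
    have nz: "c * t + d \<noteq> 0" using assms[OF t] .
    have "((\<lambda>t. inverse (c * t + d)) has_real_derivative - c * inverse (c * t + d) ^ 2) (at t within {l..u})"
      using nz by (auto intro!: derivative_eq_intros simp: power2_eq_square)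
    from DERIV_cmult[OF DERIV_power_Suc[OF this, of "Suc j"],
        of "fact (Suc j) * (a * d - b * c) * (- c) ^ j"]
    have "(r j has_real_derivative r (Suc j) t) (at t within {l..u})"
      unfolding r_def by (rule back_subst) (simp add: power2_eq_square mult_ac)
    from has_vector_derivative_scaleR[OF this has_vector_derivative_const[of v]]
    show ?thesis using Suc by (simp add: D_def)
  qed
  then show ?thesis unfolding smooth_curve_on_def by (intro exI[of _ D]) (auto simp: D_def)
qed

lemma smooth_curve_on_linepath: "smooth_curve_on l u (linepath x y)"
proof -
  have "linepath x y = (\<lambda>t. x + ((1 * t + 0) / (0 * t + 1)) *\<^sub>R (y - x))"
    by (auto simp: linepath_def algebra_simps)
  then show ?thesis using smooth_curve_on_homography[of l u 0 1 x 1 0 "y - x"] by simp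
qed

lemma smooth_curve_on_continuous: "smooth_curve_on a b \<gamma> \<Longrightarrow> continuous_on {a..b} \<gamma>"
  unfolding smooth_curve_on_def continuous_on_eq_continuous_within
  using has_vector_derivative_continuous by blast

lemma smooth_subdivision_mono:
  assumes "smooth_subdivision m \<tau> \<gamma>" "i \<le> j" "j \<le> m"
  shows "\<tau> i \<le> \<tau> j"
  using assms(2,3)
proof (induction j rule: dec_induct)
  case (step j)
  then have "\<tau> j < \<tau> (Suc j)" using assms(1) by (simp add: smooth_subdivision_def)
  then show ?case using step by simp
qed simp

lemma smooth_subdivision_Icc:
  assumes "smooth_subdivision m \<tau> \<gamma>" "i < m"
  shows "{0..\<tau> (Suc i)} = {0..\<tau> i} \<union> {\<tau> i..\<tau> (Suc i)}"
proof -
  have "0 \<le> \<tau> i" "\<tau> i \<le> \<tau> (Suc i)"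
    using smooth_subdivision_mono[OF assms(1), of 0 i]
      smooth_subdivision_mono[OF assms(1), of i "Suc i"] assms by (simp_all add: smooth_subdivision_def)
  then show ?thesis by auto
qed

lemma smooth_subdivision_continuous:
  assumes "smooth_subdivision m \<tau> \<gamma>"
  shows "continuous_on {0..1} \<gamma>"
proof -
  have "continuous_on {0..\<tau> i} \<gamma>" if "i \<le> m" for i
    using that
  proof (induction i)
    case 0
    then show ?case using assms by (simp add: smooth_subdivision_def)
  next
    case (Suc i)
    then have "smooth_curve_on (\<tau> i) (\<tau> (Suc i)) \<gamma>" using assms by (simp add: smooth_subdivision_def)
    then have "continuous_on {\<tau> i..\<tau> (Suc i)} \<gamma>" by (rule smooth_curve_on_continuous)
    moreover have "continuous_on {0..\<tau> i} \<gamma>" using Suc by simp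
    ultimately show ?case
      using smooth_subdivision_Icc[OF assms, of i] Suc(2)
        continuous_on_closed_Un[of "{0..\<tau> i}" "{\<tau> i..\<tau> (Suc i)}" \<gamma>] by simp
  qed
  from this[of m] show ?thesis using assms by (simp add: smooth_subdivision_def)
qed

lemma smooth_subdivision_piece:
  assumes "smooth_subdivision m \<tau> \<gamma>" "t \<in> {0..1}" "t \<notin> \<tau> ` {..m}"
  obtains i where "i < m" "\<tau> i < t" "t < \<tau> (Suc i)"
proof -
  have "\<exists>i<j. \<tau> i < t \<and> t < \<tau> (Suc i)" if "j \<le> m" "t < \<tau> j" for j
    using that
  proof (induction j)
    case 0
    then show ?case using assms by (simp add: smooth_subdivision_def)
  next
    case (Suc j)
    have "t \<noteq> \<tau> j" using assms(3) Suc by auto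
    then show ?case using Suc by (metis Suc_leD less_Suc_eq linorder_neqE)
  qed
  moreover have "t < \<tau> m" using assms
    by (metis atLeastAtMost_iff atMost_iff imageI order.order_iff_strict smooth_subdivision_def)
  ultimately show ?thesis using that by blast
qed

lemma piecewise_smooth_curve_continuous: "piecewise_smooth_curve \<gamma> \<Longrightarrow> continuous_on {0..1} \<gamma>"
  using smooth_subdivision_continuous unfolding piecewise_smooth_curve_def by blast

text \<open>\<open>D\<close> is continuous up to the ends of the piece, which gives integrability.
  The other two claims stop short of the ends: at a break point the derivative within
  \<open>{0..1}\<close> may fail to exist, and \<open>vector_derivative\<close> is then an arbitrary
  value.\<close>

lemma smooth_subdivision_velocity:
  fixes \<gamma> :: "real \<Rightarrow> 'a::euclidean_space"
  assumes "smooth_subdivision m \<tau> \<gamma>" "i < m"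
  obtains D where "continuous_on {\<tau> i..\<tau> (Suc i)} D"
    "\<And>t. \<tau> i < t \<Longrightarrow> t < \<tau> (Suc i) \<Longrightarrow> (\<gamma> has_vector_derivative D t) (at t)"
    "\<And>t. \<tau> i < t \<Longrightarrow> t < \<tau> (Suc i) \<Longrightarrow> vector_derivative \<gamma> (at t within {0..1}) = D t"
proof -
  let ?S = "{\<tau> i..\<tau> (Suc i)}"
  obtain D where D: "D 0 = \<gamma>"
    "\<And>k t. t \<in> ?S \<Longrightarrow> (D k has_vector_derivative D (Suc k) t) (at t within ?S)"
    using assms unfolding smooth_subdivision_def smooth_curve_on_def by blast
  have 1: "continuous_on ?S (D 1)"
    using D(2)[of _ 1] unfolding continuous_on_eq_continuous_within
    by (blast intro: has_vector_derivative_continuous)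
  have 2: "(\<gamma> has_vector_derivative D 1 t) (at t)" if "\<tau> i < t" "t < \<tau> (Suc i)" for t
    using D(2)[of t 0] D(1) that at_within_interior[of t ?S] by auto
  have 3: "vector_derivative \<gamma> (at t within {0..1}) = D 1 t" if "\<tau> i < t" "t < \<tau> (Suc i)" for t
  proof (rule vector_derivative_within_closed_interval)
    show "t \<in> {0..1}"
      using smooth_subdivision_mono[OF assms(1), of 0 i] smooth_subdivision_mono[OF assms(1), of "Suc i" m]
        that assms by (auto simp: smooth_subdivision_def)
    show "(\<gamma> has_vector_derivative D 1 t) (at t within {0..1})"
      using 2[OF that] has_vector_derivative_at_within by blast
  qed simp
  show ?thesis by (rule that[OF 1 2 3])
qed

lemma piecewise_smooth_curve_derivative:
  fixes \<gamma> :: "real \<Rightarrow> 'a::euclidean_space"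
  assumes "piecewise_smooth_curve \<gamma>"
  obtains S where "finite S" "0 \<in> S" "1 \<in> S"
    "\<And>t. t \<in> {0..1} - S \<Longrightarrow>
       (\<gamma> has_vector_derivative vector_derivative \<gamma> (at t within {0..1})) (at t)"
proof -
  obtain m \<tau> where sub: "smooth_subdivision m \<tau> \<gamma>"
    using assms unfolding piecewise_smooth_curve_def by blast
  show ?thesis
  proof (rule that[of "\<tau> ` {..m}"])
    show "0 \<in> \<tau> ` {..m}" "1 \<in> \<tau> ` {..m}"
      using sub unfolding smooth_subdivision_def by (metis atMost_iff image_eqI le0 order_refl)+
    show "(\<gamma> has_vector_derivative vector_derivative \<gamma> (at t within {0..1})) (at t)"
      if t: "t \<in> {0..1} - \<tau> ` {..m}" for t
    proof -
      obtain i where i: "i < m" "\<tau> i < t" "t < \<tau> (Suc i)"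
        using smooth_subdivision_piece[OF sub, of t] t by blast
      show ?thesis
        using smooth_subdivision_velocity[OF sub i(1)] i(2,3) by metis
    qed
  qed simp
qed

text \<open>On each piece the integrand agrees with a continuous function except at the two ends.
  The weight \<open>w\<close> is 1 for the Euclidean length and the inverse distance to the frontier
  for the quasi-hyperbolic one.\<close>

lemma piecewise_smooth_curve_integrable:
  fixes \<gamma> :: "real \<Rightarrow> 'a::euclidean_space"
  assumes "piecewise_smooth_curve \<gamma>" and w: "continuous_on {0..1} w"
  shows "(\<lambda>t. norm (vector_derivative \<gamma> (at t within {0..1})) * w t) integrable_on {0..1::real}"
    (is "?f integrable_on _")
proof -
  obtain m \<tau> where sub: "smooth_subdivision m \<tau> \<gamma>"
    using assms unfolding piecewise_smooth_curve_def by blast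
  have "?f integrable_on {0..\<tau> i}" if "i \<le> m" for i
    using that
  proof (induction i)
    case 0
    then show ?case using sub integrable_on_refl[of ?f "0::real"] by (simp add: smooth_subdivision_def)
  next
    case (Suc i)
    then have i: "i < m" by simp
    have le: "0 \<le> \<tau> i" "\<tau> i \<le> \<tau> (Suc i)" "\<tau> (Suc i) \<le> 1"
      using smooth_subdivision_mono[OF sub, of 0 i] smooth_subdivision_mono[OF sub, of i "Suc i"]
        smooth_subdivision_mono[OF sub, of "Suc i" m] i sub by (auto simp: smooth_subdivision_def)
    obtain D where D: "continuous_on {\<tau> i..\<tau> (Suc i)} D"
      "\<And>t. \<tau> i < t \<Longrightarrow> t < \<tau> (Suc i) \<Longrightarrow> vector_derivative \<gamma> (at t within {0..1}) = D t"
      using smooth_subdivision_velocity[OF sub i] by metis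
    have "continuous_on {\<tau> i..\<tau> (Suc i)} (\<lambda>t. norm (D t) * w t)"
      using D(1) continuous_on_subset[OF w, of "{\<tau> i..\<tau> (Suc i)}"] le
      by (auto intro!: continuous_intros)
    then have "(\<lambda>t. norm (D t) * w t) integrable_on {\<tau> i..\<tau> (Suc i)}"
      by (rule integrable_continuous_interval)
    then have "?f integrable_on {\<tau> i..\<tau> (Suc i)}"
      by (rule integrable_spike_finite[of "{\<tau> i, \<tau> (Suc i)}", rotated 2]) (auto simp: D(2))
    then show ?case using Suc i le
      using Henstock_Kurzweil_Integration.integrable_combine[of 0 "\<tau> i" "\<tau> (Suc i)" ?f] by simp
  qed
  from this[of m] show ?thesis using sub by (simp add: smooth_subdivision_def)
qed

lemma piecewise_smooth_curve_norm_diff_le: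
  fixes \<gamma> :: "real \<Rightarrow> 'a::euclidean_space"
  assumes "piecewise_smooth_curve \<gamma>" "0 \<le> a" "a \<le> b" "b \<le> 1"
  shows "norm (\<gamma> b - \<gamma> a) \<le> integral {a..b} (\<lambda>t. norm (vector_derivative \<gamma> (at t within {0..1})))"
proof -
  let ?D = "\<lambda>t. vector_derivative \<gamma> (at t within {0..1})"
  obtain S where S: "finite S" "\<And>t. t \<in> {0..1} - S \<Longrightarrow> (\<gamma> has_vector_derivative ?D t) (at t)"
    using piecewise_smooth_curve_derivative[OF assms(1)] by metis
  have 1: "(?D has_integral (\<gamma> b - \<gamma> a)) {a..b}"
    using assms S piecewise_smooth_curve_continuous[OF assms(1)]
    by (intro fundamental_theorem_of_calculus_interior_strong[of S])
      (auto intro: continuous_on_subset)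
  have "(\<lambda>t. norm (?D t)) integrable_on {0..1}"
    using piecewise_smooth_curve_integrable[OF assms(1), of "\<lambda>_. 1"] by simp
  then have 2: "(\<lambda>t. norm (?D t)) integrable_on {a..b}"
    by (rule integrable_on_subinterval) (use assms in auto)
  show ?thesis
    using integral_norm_bound_integral[of ?D "{a..b}" "\<lambda>t. norm (?D t)"] 1 2
    by (auto simp: integral_unique has_integral_integrable)
qed

section \<open>Quasi-hyperbolic length\<close>

lemma smooth_subdivision_join:
  fixes \<gamma> \<gamma>' :: "real \<Rightarrow> 'a::euclidean_space"
  assumes "smooth_subdivision m \<tau> \<gamma>" "smooth_subdivision m' \<tau>' \<gamma>'" and eq: "\<gamma> 1 = \<gamma>' 0"
  shows "smooth_subdivision (m + m') (\<lambda>i. if i \<le> m then \<tau> i / 2 else (1 + \<tau>' (i - m)) / 2) (\<gamma> +++ \<gamma>')"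
    (is "smooth_subdivision _ ?\<sigma> _")
proof -
  \<comment> \<open>At the seam \<open>i = m\<close> both branches give 1/2, because
    \<open>\<tau> m = 1\<close> and \<open>\<tau>' 0 = 0\<close>.\<close>
  have \<sigma>: "?\<sigma> i = (1 + \<tau>' (i - m)) / 2" if "m \<le> i" for i
    using that assms by (auto simp: smooth_subdivision_def)
  have "?\<sigma> i < ?\<sigma> (Suc i) \<and> smooth_curve_on (?\<sigma> i) (?\<sigma> (Suc i)) (\<gamma> +++ \<gamma>')" if i: "i < m + m'" for i
  proof (cases "i < m")
    case True
    have lt: "\<tau> i < \<tau> (Suc i)" and smooth: "smooth_curve_on (\<tau> i) (\<tau> (Suc i)) \<gamma>"
      using assms(1) True by (auto simp: smooth_subdivision_def)
    have "\<tau> (Suc i) \<le> 1"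
      using smooth_subdivision_mono[OF assms(1), of "Suc i" m] True assms(1)
      by (simp add: smooth_subdivision_def)
    then have "smooth_curve_on (\<tau> i / 2) (\<tau> (Suc i) / 2) (\<gamma> +++ \<gamma>')"
      by (intro smooth_curve_on_cong[OF smooth_curve_on_affine[OF smooth, of _ _ 2 0]])
        (auto simp: joinpaths_def)
    then show ?thesis using lt True by simp
  next
    case False
    define j where "j = i - m"
    have j: "j < m'" "i - m = j" "Suc i - m = Suc j" using False i by (auto simp: j_def)
    have lt: "\<tau>' j < \<tau>' (Suc j)" and smooth: "smooth_curve_on (\<tau>' j) (\<tau>' (Suc j)) \<gamma>'"
      using assms(2) j by (auto simp: smooth_subdivision_def)
    have "0 \<le> \<tau>' j"
      using smooth_subdivision_mono[OF assms(2), of 0 j] j assms(2)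
      by (simp add: smooth_subdivision_def)
    \<comment> \<open>At t = 1/2 the operator \<open>+++\<close> takes its first branch; the
      matching condition \<open>eq\<close> identifies it with the second.\<close>
    then have "(\<gamma> +++ \<gamma>') t = \<gamma>' (2 * t + -1)" if "t \<in> {(1 + \<tau>' j) / 2..(1 + \<tau>' (Suc j)) / 2}" for t
      using that eq by (cases "2 * t = 1") (auto simp: joinpaths_def)
    then have "smooth_curve_on ((1 + \<tau>' j) / 2) ((1 + \<tau>' (Suc j)) / 2) (\<gamma> +++ \<gamma>')"
      by (intro smooth_curve_on_cong[OF smooth_curve_on_affine[OF smooth, of _ _ 2 "-1"]]) auto
    moreover have "?\<sigma> i = (1 + \<tau>' j) / 2" "?\<sigma> (Suc i) = (1 + \<tau>' (Suc j)) / 2"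
      using \<sigma>[of i] \<sigma>[of "Suc i"] False j by simp_all
    ultimately show ?thesis using lt by (simp only:) simp
  qed
  moreover have "?\<sigma> 0 = 0" "?\<sigma> (m + m') = 1"
    using \<sigma>[of "m + m'"] assms by (simp_all add: smooth_subdivision_def)
  ultimately show ?thesis unfolding smooth_subdivision_def by blast
qed

lemma piecewise_smooth_curve_join:
  fixes \<gamma> \<gamma>' :: "real \<Rightarrow> 'a::euclidean_space"
  assumes "piecewise_smooth_curve \<gamma>" "piecewise_smooth_curve \<gamma>'" "\<gamma> 1 = \<gamma>' 0"
  shows "piecewise_smooth_curve (\<gamma> +++ \<gamma>')"
  using assms smooth_subdivision_join unfolding piecewise_smooth_curve_def by blast

lemma image_joinpaths_Icc:
  assumes "\<gamma> ` {0..1} \<subseteq> S" "\<gamma>' ` {0..1} \<subseteq> S"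
  shows "(\<gamma> +++ \<gamma>') ` {0..1} \<subseteq> S"
  using path_image_join_subset[of \<gamma> \<gamma>'] assms unfolding path_image_def by blast

lemma vector_derivative_joinpaths_left:
  fixes \<gamma> \<gamma>' :: "real \<Rightarrow> 'a::euclidean_space"
  assumes "0 < t" "t < 1 / 2" "(\<gamma> has_vector_derivative D) (at (2 * t))"
  shows "vector_derivative (\<gamma> +++ \<gamma>') (at t within {0..1}) = 2 *\<^sub>R D"
proof -
  have "((\<lambda>t. 2 * t) has_vector_derivative 2) (at t)"
    unfolding has_real_derivative_iff_has_vector_derivative[symmetric]
    by (auto intro!: derivative_eq_intros)
  from vector_diff_chain_at[OF this assms(3)]
  have "((\<lambda>t. \<gamma> (2 * t)) has_vector_derivative 2 *\<^sub>R D) (at t)" by (simp add: o_def)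
  then have "((\<gamma> +++ \<gamma>') has_vector_derivative 2 *\<^sub>R D) (at t)"
    by (rule has_vector_derivative_transform_within_open[of _ _ _ "{..<1/2}"])
      (use assms in \<open>auto simp: joinpaths_def\<close>)
  then show ?thesis
    using vector_derivative_within_closed_interval[of 0 1 t "\<gamma> +++ \<gamma>'" "2 *\<^sub>R D"]
      has_vector_derivative_at_within[of "\<gamma> +++ \<gamma>'" "2 *\<^sub>R D" t] assms by simp
qed

lemma vector_derivative_joinpaths_right:
  fixes \<gamma> \<gamma>' :: "real \<Rightarrow> 'a::euclidean_space"
  assumes "1 / 2 < t" "t < 1" "(\<gamma>' has_vector_derivative D) (at (2 * t - 1))"
  shows "vector_derivative (\<gamma> +++ \<gamma>') (at t within {0..1}) = 2 *\<^sub>R D"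
proof -
  have "((\<lambda>t. 2 * t - 1) has_vector_derivative 2) (at t)"
    unfolding has_real_derivative_iff_has_vector_derivative[symmetric]
    by (auto intro!: derivative_eq_intros)
  from vector_diff_chain_at[OF this assms(3)]
  have "((\<lambda>t. \<gamma>' (2 * t - 1)) has_vector_derivative 2 *\<^sub>R D) (at t)" by (simp add: o_def)
  then have "((\<gamma> +++ \<gamma>') has_vector_derivative 2 *\<^sub>R D) (at t)"
    by (rule has_vector_derivative_transform_within_open[of _ _ _ "{1/2<..}"])
      (use assms in \<open>auto simp: joinpaths_def\<close>)
  then show ?thesis
    using vector_derivative_within_closed_interval[of 0 1 t "\<gamma> +++ \<gamma>'" "2 *\<^sub>R D"]
      has_vector_derivative_at_within[of "\<gamma> +++ \<gamma>'" "2 *\<^sub>R D" t] assms by simp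
qed

section \<open>Distance to the frontier\<close>

lemma domain_frontier_nonempty: "domain \<Omega> \<Longrightarrow> frontier \<Omega> \<noteq> {}"
  unfolding domain_def using frontier_eq_empty by blast

text \<open>Positivity rests on a nonempty frontier as well as on openness: \<open>infdist\<close>
  to the empty set is 0 by convention.\<close>

lemma infdist_frontier_pos:
  assumes "domain \<Omega>" "x \<in> \<Omega>"
  shows "0 < infdist x (frontier \<Omega>)"
proof -
  have "x \<notin> frontier \<Omega>" using assms unfolding domain_def frontier_def by (simp add: interior_open)
  then show ?thesis
    using infdist_pos_not_in_closed[OF frontier_closed domain_frontier_nonempty[OF assms(1)]] by blast
qed

text \<open>A ball is connected, so one that meets both \<open>\<Omega>\<close> and its complement
  would meet the frontier.\<close>

lemma infdist_frontier_ball_subset: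
  assumes "domain \<Omega>" "x \<in> \<Omega>"
  shows "ball x (infdist x (frontier \<Omega>)) \<subseteq> \<Omega>"
proof (rule ccontr)
  let ?B = "ball x (infdist x (frontier \<Omega>))"
  assume "\<not> ?B \<subseteq> \<Omega>"
  moreover have "?B \<inter> \<Omega> \<noteq> {}" using assms infdist_frontier_pos[OF assms] centre_in_ball by blast
  ultimately have "?B \<inter> frontier \<Omega> \<noteq> {}"
    by (intro connected_Int_frontier) blast+
  then obtain z where "z \<in> frontier \<Omega>" "dist x z < infdist x (frontier \<Omega>)" by auto
  then show False using infdist_le[of z "frontier \<Omega>" x] by simp
qed

lemma continuous_on_inverse_infdist_frontier:
  assumes "domain \<Omega>" "continuous_on S \<gamma>" "\<gamma> ` S \<subseteq> \<Omega>"
  shows "continuous_on S (\<lambda>t. inverse (infdist (\<gamma> t) (frontier \<Omega>)))"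
proof -
  have "infdist (\<gamma> t) (frontier \<Omega>) \<noteq> 0" if "t \<in> S" for t
    using infdist_frontier_pos[OF assms(1), of "\<gamma> t"] assms(3) that by force
  then show ?thesis by (intro continuous_on_inverse continuous_on_infdist assms(2)) simp
qed

lemma quasihyperbolic_integrable:
  assumes "domain \<Omega>" "piecewise_smooth_curve \<gamma>" "\<gamma> ` {0..1} \<subseteq> \<Omega>"
  shows "(\<lambda>t. norm (vector_derivative \<gamma> (at t within {0..1})) / infdist (\<gamma> t) (frontier \<Omega>))
           integrable_on {0..1}"
  using piecewise_smooth_curve_integrable[OF assms(2)
      continuous_on_inverse_infdist_frontier[OF assms(1) piecewise_smooth_curve_continuous[OF assms(2)] assms(3)]]
  by (simp add: divide_inverse)

text \<open>Each half is run through at double speed in half the time, so the change of variable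
  cancels the factor 2 of the velocity. The velocity formula may fail at the rescaled break points,
  a finite set.\<close>

lemma quasihyperbolic_length_join:
  assumes "domain \<Omega>"
    and "piecewise_smooth_curve \<gamma>" "\<gamma> ` {0..1} \<subseteq> \<Omega>"
    and "piecewise_smooth_curve \<gamma>'" "\<gamma>' ` {0..1} \<subseteq> \<Omega>"
  shows "quasihyperbolic_length \<Omega> (\<gamma> +++ \<gamma>') =
           quasihyperbolic_length \<Omega> \<gamma> + quasihyperbolic_length \<Omega> \<gamma>'"
proof -
  let ?f = "\<lambda>\<gamma> t. norm (vector_derivative \<gamma> (at t within {0..1})) / infdist (\<gamma> t) (frontier \<Omega>)"
  obtain S where S: "finite S" "0 \<in> S" "1 \<in> S"
    "\<And>t. t \<in> {0..1} - S \<Longrightarrow> (\<gamma> has_vector_derivative vector_derivative \<gamma> (at t within {0..1})) (at t)"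
    using piecewise_smooth_curve_derivative[OF assms(2)] by metis
  obtain S' where S': "finite S'" "0 \<in> S'" "1 \<in> S'"
    "\<And>t. t \<in> {0..1} - S' \<Longrightarrow> (\<gamma>' has_vector_derivative vector_derivative \<gamma>' (at t within {0..1})) (at t)"
    using piecewise_smooth_curve_derivative[OF assms(4)] by metis
  have "(?f \<gamma> has_integral quasihyperbolic_length \<Omega> \<gamma>) (cbox 0 1)"
    unfolding quasihyperbolic_length_def
    using integrable_integral[OF quasihyperbolic_integrable[OF assms(1-3)]] by simp
  from has_integral_mult_right[OF has_integral_affinity'[OF this, of 2 0], of 2]
  have 1: "((\<lambda>t. 2 * ?f \<gamma> (2 * t)) has_integral quasihyperbolic_length \<Omega> \<gamma>) {0..1/2}"
    by simp
  have 2: "(?f (\<gamma> +++ \<gamma>') has_integral quasihyperbolic_length \<Omega> \<gamma>) {0..1/2}"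
  proof (rule has_integral_spike_finite[OF _ _ 1])
    show "finite ((\<lambda>t. t / 2) ` S)" using S(1) by simp
    fix t assume t: "t \<in> {0..1/2} - (\<lambda>t. t / 2) ` S"
    have "2 * t \<notin> S" using t image_eqI[of t "\<lambda>t. t / 2" "2 * t" S] by auto
    then have "2 * t \<in> {0..1} - S" "2 * t \<noteq> 0" "2 * t \<noteq> 1" using t S(2,3) by auto
    then show "?f (\<gamma> +++ \<gamma>') t = 2 * ?f \<gamma> (2 * t)"
      using vector_derivative_joinpaths_left[OF _ _ S(4)[of "2 * t"], of \<gamma>'] t by (simp add: joinpaths_def)
  qed
  have "(?f \<gamma>' has_integral quasihyperbolic_length \<Omega> \<gamma>') (cbox 0 1)"
    unfolding quasihyperbolic_length_def
    using integrable_integral[OF quasihyperbolic_integrable[OF assms(1,4,5)]] by simp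
  from has_integral_mult_right[OF has_integral_affinity'[OF this, of 2 "-1"], of 2]
  have 3: "((\<lambda>t. 2 * ?f \<gamma>' (2 * t - 1)) has_integral quasihyperbolic_length \<Omega> \<gamma>') {1/2..1}"
    by simp
  have 4: "(?f (\<gamma> +++ \<gamma>') has_integral quasihyperbolic_length \<Omega> \<gamma>') {1/2..1}"
  proof (rule has_integral_spike_finite[OF _ _ 3])
    show "finite ((\<lambda>t. (t + 1) / 2) ` S')" using S'(1) by simp
    fix t assume t: "t \<in> {1/2..1} - (\<lambda>t. (t + 1) / 2) ` S'"
    have "2 * t - 1 \<notin> S'" using t image_eqI[of t "\<lambda>t. (t + 1) / 2" "2 * t - 1" S'] by auto
    then have "2 * t - 1 \<in> {0..1} - S'" "2 * t - 1 \<noteq> 0" "2 * t - 1 \<noteq> 1" using t S'(2,3) by auto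
    then show "?f (\<gamma> +++ \<gamma>') t = 2 * ?f \<gamma>' (2 * t - 1)"
      using vector_derivative_joinpaths_right[OF _ _ S'(4)[of "2 * t - 1"], of \<gamma>] t by (simp add: joinpaths_def)
  qed
  show ?thesis
    unfolding quasihyperbolic_length_def[of _ "\<gamma> +++ \<gamma>'"]
    using has_integral_combine[OF _ _ 2 4] by (simp add: integral_unique)
qed

text \<open>
  A bound attained by a single curve, with real values: subadditivity then requires no approximation
  of infima in \<open>ennreal\<close>.
\<close>

definition quasihyperbolic_reach where
  "quasihyperbolic_reach \<Omega> x y l \<longleftrightarrow>
     (\<exists>\<gamma>. piecewise_smooth_curve \<gamma> \<and> \<gamma> ` {0..1} \<subseteq> \<Omega> \<and> \<gamma> 0 = x \<and> \<gamma> 1 = y \<and>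
        quasihyperbolic_length \<Omega> \<gamma> \<le> l)"

lemma quasihyperbolic_reach_trans:
  assumes "domain \<Omega>" "quasihyperbolic_reach \<Omega> x y l" "quasihyperbolic_reach \<Omega> y z l'"
  shows "quasihyperbolic_reach \<Omega> x z (l + l')"
proof -
  obtain \<gamma> \<gamma>' where \<gamma>: "piecewise_smooth_curve \<gamma>" "\<gamma> ` {0..1} \<subseteq> \<Omega>" "\<gamma> 0 = x" "\<gamma> 1 = y"
      "quasihyperbolic_length \<Omega> \<gamma> \<le> l"
    and \<gamma>': "piecewise_smooth_curve \<gamma>'" "\<gamma>' ` {0..1} \<subseteq> \<Omega>" "\<gamma>' 0 = y" "\<gamma>' 1 = z"
      "quasihyperbolic_length \<Omega> \<gamma>' \<le> l'"
    using assms unfolding quasihyperbolic_reach_def by blast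
  have "quasihyperbolic_length \<Omega> (\<gamma> +++ \<gamma>') \<le> l + l'"
    using quasihyperbolic_length_join[OF assms(1) \<gamma>(1,2) \<gamma>'(1,2)] \<gamma>(5) \<gamma>'(5) by simp
  moreover have "(\<gamma> +++ \<gamma>') 0 = x" "(\<gamma> +++ \<gamma>') 1 = z" using \<gamma> \<gamma>' by (simp_all add: joinpaths_def)
  moreover have "piecewise_smooth_curve (\<gamma> +++ \<gamma>')"
    using piecewise_smooth_curve_join[OF \<gamma>(1) \<gamma>'(1)] \<gamma>(4) \<gamma>'(3) by simp
  ultimately show ?thesis
    using image_joinpaths_Icc[OF \<gamma>(2) \<gamma>'(2)] unfolding quasihyperbolic_reach_def by blast
qed

lemma quasihyperbolic_dist_le:
  "quasihyperbolic_reach \<Omega> x y l \<Longrightarrow> quasihyperbolic_dist \<Omega> x y \<le> ennreal l"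
proof -
  assume "quasihyperbolic_reach \<Omega> x y l"
  then obtain \<gamma> where "piecewise_smooth_curve \<gamma> \<and> \<gamma> ` {0..1} \<subseteq> \<Omega> \<and> \<gamma> 0 = x \<and> \<gamma> 1 = y"
      and "quasihyperbolic_length \<Omega> \<gamma> \<le> l"
    unfolding quasihyperbolic_reach_def by blast
  then show ?thesis
    unfolding quasihyperbolic_dist_def by (intro INF_lower2[of \<gamma>] ennreal_leI) simp_all
qed

section \<open>Causally convex domains as regions between graphs\<close>

lemma future_causalI:
  assumes "norm (snd v) \<le> (1 + \<epsilon>) * fst v" "0 < fst v"
  shows "future_causal \<epsilon> v"
proof -
  have "(norm (snd v))\<^sup>2 \<le> ((1 + \<epsilon>) * fst v)\<^sup>2" using assms(1) by (intro power_mono) auto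
  then have "snd v \<bullet> snd v \<le> (1 + \<epsilon>)\<^sup>2 * (fst v * fst v)"
    by (simp add: power2_norm_eq_inner power_mult_distrib power2_eq_square[of "fst v"])
  then show ?thesis
    using assms(2) unfolding future_causal_def causal_def lorentz_form_def by auto
qed

lemma smooth_subdivision_1:
  assumes "smooth_curve_on 0 1 \<gamma>"
  shows "smooth_subdivision 1 real \<gamma>"
  using assms by (simp add: smooth_subdivision_def)

lemma causally_related_linepath:
  assumes "norm (snd y - snd x) \<le> (1 + \<epsilon>) * (fst y - fst x)" "fst x < fst y"
  shows "causally_related \<epsilon> x y"
proof -
  have "vector_derivative (linepath x y) (at t within {0..1}) = y - x" if "t \<in> {0..1}" for t
    using that by (intro vector_derivative_within_closed_interval has_vector_derivative_linepath_within) auto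
  moreover have "future_causal \<epsilon> (y - x)" using assms by (intro future_causalI) auto
  ultimately have "causal_curve \<epsilon> (linepath x y)"
    unfolding causal_curve_def
    by (intro exI[of _ 1] exI[of _ real] conjI disjI1 smooth_subdivision_1 smooth_curve_on_linepath) auto
  then show ?thesis unfolding causally_related_def by (intro exI[of _ "linepath x y"]) (simp add: linepath_def)
qed

text \<open>Causal convexity speaks of curves, so a prescribed point is reached by a curve bent
  there. At the bend the two one-sided velocities are tested separately, each on its own
  piece.\<close>

lemma causal_curve_broken_line:
  assumes AB: "norm (snd B - snd A) \<le> fst B - fst A" "fst A < fst B"
    and BC: "norm (snd C - snd B) \<le> fst C - fst B" "fst B < fst C"
  shows "causal_curve 0 (linepath A B +++ linepath B C)"
proof -
  \<comment> \<open>This is the form in which \<open>smooth_subdivision_join\<close> returns the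
    subdivision 0, 1/2, 1 of two curves with the single piece [0, 1].\<close>
  define \<tau> where "\<tau> = (\<lambda>i::nat. if i \<le> 1 then real i / 2 else (1 + real (i - 1)) / 2)"
  have \<tau>: "\<tau> 0 = 0" "\<tau> (Suc 0) = 1 / 2" "\<tau> (Suc (Suc 0)) = 1" by (simp_all add: \<tau>_def)
  have sub: "smooth_subdivision (1 + 1) \<tau> (linepath A B +++ linepath B C)"
    unfolding \<tau>_def
    by (intro smooth_subdivision_join smooth_subdivision_1 smooth_curve_on_linepath) (simp add: linepath_def)
  have D: "((\<lambda>t. linepath P Q (2 * t + e)) has_vector_derivative 2 *\<^sub>R (Q - P)) (at t within S)"
    for P Q :: "'a spacetime" and e t :: real and S
  proof -
    have "((\<lambda>t. 2 * t + e) has_vector_derivative 2) (at t within S)"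
      unfolding has_real_derivative_iff_has_vector_derivative[symmetric]
      by (auto intro!: derivative_eq_intros)
    from vector_diff_chain_within[OF this has_vector_derivative_linepath_within]
    show ?thesis by (simp add: o_def)
  qed
  have vd0: "vector_derivative (linepath A B +++ linepath B C) (at t within {0..1/2}) = 2 *\<^sub>R (B - A)"
    if "t \<in> {0..1/2}" for t
    by (rule vector_derivative_within_closed_interval[OF _ that has_vector_derivative_transform[OF that _ D[of A B 0]]])
      (auto simp: joinpaths_def)
  have right: "(linepath A B +++ linepath B C) x = linepath B C (2 * x + -1)" if "x \<in> {1/2..1}" for x
  proof (cases "1/2 < x")
    case False
    then have "x = 1/2" using that by auto
    then show ?thesis unfolding \<open>x = 1/2\<close> by (simp add: joinpaths_def linepath_def)
  qed (simp add: joinpaths_def)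
  have vd1: "vector_derivative (linepath A B +++ linepath B C) (at t within {1/2..1}) = 2 *\<^sub>R (C - B)"
    if "t \<in> {1/2..1}" for t
    by (rule vector_derivative_within_closed_interval[OF _ that has_vector_derivative_transform[OF that right D[of B C "-1"]]])
      auto
  have fut: "future_causal 0 (2 *\<^sub>R (B - A))" "future_causal 0 (2 *\<^sub>R (C - B))"
    using AB BC by (auto intro!: future_causalI simp: scaleR_diff_right[symmetric])
  have "\<forall>i<1+1. \<forall>t\<in>{\<tau> i..\<tau> (Suc i)}.
      future_causal 0 (vector_derivative (linepath A B +++ linepath B C) (at t within {\<tau> i..\<tau> (Suc i)}))"
  proof (intro allI impI ballI)
    fix i t assume "i < 1 + (1::nat)" and t: "t \<in> {\<tau> i..\<tau> (Suc i)}"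
    then consider "i = 0" | "i = 1" by linarith
    then show "future_causal 0 (vector_derivative (linepath A B +++ linepath B C) (at t within {\<tau> i..\<tau> (Suc i)}))"
    proof cases
      case 1
      then show ?thesis using t vd0[of t] fut(1) by (simp add: \<tau>)
    next
      case 2
      then show ?thesis using t vd1[of t] fut(2) by (simp add: \<tau>)
    qed
  qed
  with sub show ?thesis unfolding causal_curve_def by blast
qed

lemma causally_convex_between:
  assumes "causally_convex \<Omega>" "A \<in> \<Omega>" "C \<in> \<Omega>"
    and "dist (snd A) (snd B) < fst B - fst A" "dist (snd B) (snd C) < fst C - fst B"
  shows "B \<in> \<Omega>"
proof -
  let ?\<gamma> = "linepath A B +++ linepath B C"
  have "fst A < fst B" "fst B < fst C"
    using assms(4,5) zero_le_dist[of "snd A" "snd B"] zero_le_dist[of "snd B" "snd C"] by linarith+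
  then have "causal_curve 0 ?\<gamma>"
    using assms(4,5) by (intro causal_curve_broken_line) (auto simp: dist_norm norm_minus_commute)
  moreover have "?\<gamma> 0 = A" "?\<gamma> 1 = C" "?\<gamma> (1/2) = B" by (auto simp: joinpaths_def linepath_def)
  ultimately have "?\<gamma> ` {0..1} \<subseteq> \<Omega>" using assms(1-3) unfolding causally_convex_def by metis
  moreover have "?\<gamma> (1/2) \<in> ?\<gamma> ` {0..1}" by (rule imageI) simp
  ultimately show ?thesis using \<open>?\<gamma> (1/2) = B\<close> by auto
qed

text \<open>
  The graphs of these two functions bound the past and the future of \<open>\<Omega>\<close>. Both are 1-Lipschitz on the
  whole space by construction, so no extension from the projection of \<open>\<Omega>\<close> to its closure is needed.
\<close>

definition upper_graph :: "'n::finite spacetime set \<Rightarrow> real ^ 'n \<Rightarrow> ereal" where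
  "upper_graph \<Omega> p = (SUP z\<in>\<Omega>. ereal (fst z - dist p (snd z)))"

definition lower_graph :: "'n::finite spacetime set \<Rightarrow> real ^ 'n \<Rightarrow> ereal" where
  "lower_graph \<Omega> p = (INF z\<in>\<Omega>. ereal (fst z + dist p (snd z)))"

lemma upper_graph_lipschitz: "upper_graph \<Omega> p \<le> upper_graph \<Omega> q + ereal (dist p q)"
  unfolding upper_graph_def
proof (rule SUP_least)
  fix z assume "z \<in> \<Omega>"
  have "ereal (fst z - dist p (snd z)) \<le> ereal (fst z - dist q (snd z)) + ereal (dist p q)"
    using dist_triangle[of q "snd z" p] by (simp add: dist_commute)
  also have "\<dots> \<le> (SUP z\<in>\<Omega>. ereal (fst z - dist q (snd z))) + ereal (dist p q)"
    using \<open>z \<in> \<Omega>\<close> by (intro add_right_mono SUP_upper)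
  finally show "ereal (fst z - dist p (snd z)) \<le> \<dots>" .
qed

lemma lower_graph_lipschitz: "lower_graph \<Omega> p \<le> lower_graph \<Omega> q + ereal (dist p q)"
proof -
  \<comment> \<open>Moving the distance to the left leaves a bare infimum on the right, ready for
    \<open>INF_greatest\<close>.\<close>
  have "lower_graph \<Omega> p - ereal (dist p q) \<le> lower_graph \<Omega> q"
    unfolding lower_graph_def[of _ q]
  proof (rule INF_greatest)
    fix z assume "z \<in> \<Omega>"
    then have "lower_graph \<Omega> p \<le> ereal (fst z + dist p (snd z))"
      unfolding lower_graph_def by (rule INF_lower)
    also have "\<dots> \<le> ereal (fst z + dist q (snd z)) + ereal (dist p q)"
      using dist_triangle[of p "snd z" q] by simp
    finally show "lower_graph \<Omega> p - ereal (dist p q) \<le> ereal (fst z + dist q (snd z))"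
      by (simp add: ereal_minus_le)
  qed
  then show ?thesis by (simp add: ereal_minus_le)
qed

text \<open>Strictness comes from openness, which leaves room above and below a point. Conversely a
  strict inequality against a supremum or infimum is witnessed by a single point: (t, p) then lies
  inside the future cone of some \<open>A\<close> and the past cone of some \<open>C\<close> in
  \<open>\<Omega>\<close>, and \<open>causally_convex_between\<close> applies.\<close>

lemma between_graphs_iff:
  assumes "open \<Omega>" "causally_convex \<Omega>"
  shows "(t, p) \<in> \<Omega> \<longleftrightarrow> lower_graph \<Omega> p < ereal t \<and> ereal t < upper_graph \<Omega> p"
proof
  assume "(t, p) \<in> \<Omega>"
  then obtain e where e: "0 < e" "\<And>y. dist y (t, p) < e \<Longrightarrow> y \<in> \<Omega>"
    using assms(1) unfolding open_dist by blast
  have "(t + e / 2, p) \<in> \<Omega>" "(t - e / 2, p) \<in> \<Omega>"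
    using e(1) by (auto intro!: e(2) simp: dist_Pair_Pair dist_real_def)
  then have "ereal (t + e / 2) \<le> upper_graph \<Omega> p" "lower_graph \<Omega> p \<le> ereal (t - e / 2)"
    unfolding upper_graph_def lower_graph_def
    by (auto intro!: SUP_upper2[of "(t + e / 2, p)"] INF_lower2[of "(t - e / 2, p)"])
  moreover have "ereal t < ereal (t + e / 2)" "ereal (t - e / 2) < ereal t" using e(1) by auto
  ultimately show "lower_graph \<Omega> p < ereal t \<and> ereal t < upper_graph \<Omega> p"
    using less_le_trans le_less_trans by blast
next
  assume "lower_graph \<Omega> p < ereal t \<and> ereal t < upper_graph \<Omega> p"
  then obtain A C where A: "A \<in> \<Omega>" "ereal (fst A + dist p (snd A)) < ereal t"
    and C: "C \<in> \<Omega>" "ereal t < ereal (fst C - dist p (snd C))"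
    unfolding lower_graph_def upper_graph_def INF_less_iff less_SUP_iff by blast
  show "(t, p) \<in> \<Omega>"
    by (rule causally_convex_between[OF assms(2) A(1) C(1)]) (use A(2) C(2) in \<open>auto simp: dist_commute\<close>)
qed

lemma closure_near:
  fixes z :: "'n::finite spacetime"
  assumes "z \<in> closure \<Omega>" "0 < e"
  obtains y where "y \<in> \<Omega>" "\<bar>fst y - fst z\<bar> < e" "dist (snd y) (snd z) < e"
proof -
  obtain y where y: "y \<in> \<Omega>" "dist y z < e" using assms closure_approachable by blast
  have "dist (fst y) (fst z) < e" "dist (snd y) (snd z) < e"
    using dist_fst_le[of y z] dist_snd_le[of y z] y(2) by linarith+
  then show ?thesis using that y(1) by (auto simp: dist_real_def)
qed

text \<open>The inequalities survive in weak form because the graphs are 1-Lipschitz: the slack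
  \<open>e\<close> is spent half on the time and half on the space displacement of a nearby point of
  \<open>\<Omega>\<close>.\<close>

lemma graphs_on_closure:
  assumes "open \<Omega>" "causally_convex \<Omega>" "(s, q) \<in> closure \<Omega>"
  shows "lower_graph \<Omega> q \<le> ereal s" "ereal s \<le> upper_graph \<Omega> q"
proof -
  have "lower_graph \<Omega> q \<le> ereal s + ereal e \<and> ereal s \<le> upper_graph \<Omega> q + ereal e" if "0 < e" for e
  proof -
    have "0 < e / 2" using that by simp
    then obtain y where y: "y \<in> \<Omega>" "\<bar>fst y - s\<bar> < e / 2" "dist (snd y) q < e / 2"
      using closure_near[OF assms(3)] by (metis fst_conv snd_conv)
    have b: "lower_graph \<Omega> (snd y) < ereal (fst y)" "ereal (fst y) < upper_graph \<Omega> (snd y)"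
      using between_graphs_iff[OF assms(1,2), of "fst y" "snd y"] y(1) by auto
    have "lower_graph \<Omega> q \<le> lower_graph \<Omega> (snd y) + ereal (dist q (snd y))" by (rule lower_graph_lipschitz)
    also have "\<dots> \<le> ereal (fst y) + ereal (dist q (snd y))" using b by (intro add_right_mono less_imp_le)
    also have "\<dots> \<le> ereal s + ereal e"
    proof -
      have "fst y + dist q (snd y) \<le> s + e"
        using y(2,3) dist_commute[of q "snd y"] by linarith
      then show ?thesis by simp
    qed
    finally have 1: "lower_graph \<Omega> q \<le> ereal s + ereal e" .
    have "s \<le> fst y + e / 2" using y(2) by linarith
    then have "ereal s \<le> ereal (fst y) + ereal (e / 2)" by simp
    also have "\<dots> \<le> upper_graph \<Omega> (snd y) + ereal (e / 2)" using b by (intro add_right_mono less_imp_le)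
    also have "\<dots> \<le> upper_graph \<Omega> q + ereal (dist (snd y) q) + ereal (e / 2)"
      by (intro add_right_mono upper_graph_lipschitz)
    also have "\<dots> \<le> upper_graph \<Omega> q + ereal (e / 2) + ereal (e / 2)"
      using y(3) by (intro add_right_mono add_left_mono) simp
    also have "\<dots> = upper_graph \<Omega> q + ereal e" by (simp add: add.assoc)
    finally show ?thesis using 1 by simp
  qed
  then show "lower_graph \<Omega> q \<le> ereal s" "ereal s \<le> upper_graph \<Omega> q"
    using ereal_le_epsilon2 by blast+
qed

lemma lower_graph_le_upper_graph:
  assumes "open \<Omega>" "causally_convex \<Omega>" "p \<in> closure (snd ` \<Omega>)"
  shows "lower_graph \<Omega> p \<le> upper_graph \<Omega> p"
proof -
  have "lower_graph \<Omega> p \<le> upper_graph \<Omega> p + ereal e" if "0 < e" for e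
  proof -
    have "0 < e / 2" using that by simp
    then obtain y where y: "y \<in> \<Omega>" "dist (snd y) p < e / 2"
      using assms(3) unfolding closure_approachable by blast
    have b: "lower_graph \<Omega> (snd y) \<le> upper_graph \<Omega> (snd y)"
      using between_graphs_iff[OF assms(1,2), of "fst y" "snd y"] y(1) by auto
    have "lower_graph \<Omega> p \<le> lower_graph \<Omega> (snd y) + ereal (dist p (snd y))" by (rule lower_graph_lipschitz)
    also have "\<dots> \<le> upper_graph \<Omega> (snd y) + ereal (e / 2)"
      using b y(2) by (intro add_mono) (simp_all add: dist_commute)
    also have "\<dots> \<le> upper_graph \<Omega> p + ereal (dist (snd y) p) + ereal (e / 2)"
      by (intro add_right_mono upper_graph_lipschitz)
    also have "\<dots> \<le> upper_graph \<Omega> p + ereal (e / 2) + ereal (e / 2)"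
      using y(2) by (intro add_right_mono add_left_mono) simp
    also have "\<dots> = upper_graph \<Omega> p + ereal e" by (simp add: add.assoc)
    finally show ?thesis .
  qed
  then show ?thesis using ereal_le_epsilon2 by blast
qed

text \<open>The causal boundaries are unions over representations. Exhibiting one puts the finite
  points of both graphs into these boundaries, so that stable acausality, a condition on pairs of
  points, becomes a condition on \<open>upper_graph\<close> and \<open>lower_graph\<close>.\<close>

lemma graph_representation_graphs:
  assumes "open \<Omega>" "causally_convex \<Omega>"
  shows "graph_representation \<Omega> (snd ` \<Omega>) (lower_graph \<Omega>) (upper_graph \<Omega>)"
proof -
  let ?U = "snd ` \<Omega>"
  have U: "open ?U" using assms(1) by (rule open_image_snd)
  have iff: "(t, p) \<in> \<Omega> \<longleftrightarrow> lower_graph \<Omega> p < ereal t \<and> ereal t < upper_graph \<Omega> p" for t p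
    using between_graphs_iff[OF assms] .
  have "lower_graph \<Omega> p < upper_graph \<Omega> p" if "p \<in> ?U" for p
    using that iff by force
  moreover have "lower_graph \<Omega> p = upper_graph \<Omega> p" if p: "p \<in> frontier ?U" for p
  proof -
    have "p \<in> closure ?U" "p \<notin> ?U" using p U by (simp_all add: frontier_def interior_open)
    then have "lower_graph \<Omega> p \<le> upper_graph \<Omega> p" by (intro lower_graph_le_upper_graph assms)
    \<comment> \<open>A gap at \<open>p\<close> would contain a real \<open>t\<close>; then (t, p)
      would be in \<open>\<Omega>\<close> and \<open>p\<close> in its projection.\<close>
    moreover have "\<not> lower_graph \<Omega> p < upper_graph \<Omega> p"
    proof
      assume "lower_graph \<Omega> p < upper_graph \<Omega> p"
      then obtain t where "lower_graph \<Omega> p < ereal t" "ereal t < upper_graph \<Omega> p"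
        using ereal_dense2 by blast
      then have "(t, p) \<in> \<Omega>" using iff by blast
      with \<open>p \<notin> ?U\<close> show False by force
    qed
    ultimately show ?thesis by simp
  qed
  moreover have "\<Omega> = {(t, p). p \<in> ?U \<and> lower_graph \<Omega> p < ereal t \<and> ereal t < upper_graph \<Omega> p}"
    using iff by force
  ultimately show ?thesis
    unfolding graph_representation_def lipschitz1_ereal_on_def
    using U upper_graph_lipschitz lower_graph_lipschitz by auto
qed

section \<open>Boundary points and their Lipschitz estimate\<close>

lemma future_causal_boundaryI:
  assumes "open \<Omega>" "causally_convex \<Omega>" "p \<in> closure (snd ` \<Omega>)" "upper_graph \<Omega> p = ereal t"
  shows "(t, p) \<in> future_causal_boundary \<Omega>"
proof -
  have "\<exists>U fm fp. graph_representation \<Omega> U fm fp \<and> p \<in> closure U \<and> fp p = ereal t"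
    by (intro exI conjI) (rule graph_representation_graphs[OF assms(1,2)] assms(3,4))+
  then show ?thesis unfolding future_causal_boundary_def by simp
qed

lemma past_causal_boundaryI:
  assumes "open \<Omega>" "causally_convex \<Omega>" "p \<in> closure (snd ` \<Omega>)" "lower_graph \<Omega> p = ereal t"
  shows "(t, p) \<in> past_causal_boundary \<Omega>"
proof -
  have "\<exists>U fm fp. graph_representation \<Omega> U fm fp \<and> p \<in> closure U \<and> fm p = ereal t"
    by (intro exI conjI) (rule graph_representation_graphs[OF assms(1,2)] assms(3,4))+
  then show ?thesis unfolding past_causal_boundary_def by simp
qed

text \<open>A frontier point satisfies both weak inequalities of the closure but, lying outside the
  open set \<open>\<Omega>\<close>, fails one of the strict ones.\<close>

lemma frontier_on_graphs:
  assumes "open \<Omega>" "causally_convex \<Omega>" "(s, q) \<in> frontier \<Omega>"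
  shows "q \<in> closure (snd ` \<Omega>)" "upper_graph \<Omega> q = ereal s \<or> lower_graph \<Omega> q = ereal s"
proof -
  have cl: "(s, q) \<in> closure \<Omega>" "(s, q) \<notin> \<Omega>"
    using assms(1,3) by (simp_all add: frontier_def interior_open)
  show "q \<in> closure (snd ` \<Omega>)"
    unfolding closure_approachable
  proof (intro allI impI)
    fix e :: real assume "0 < e"
    from closure_near[OF cl(1) this] show "\<exists>y\<in>snd ` \<Omega>. dist y q < e" by (metis imageI snd_conv)
  qed
  show "upper_graph \<Omega> q = ereal s \<or> lower_graph \<Omega> q = ereal s"
    using graphs_on_closure[OF assms(1,2) cl(1)] cl(2) between_graphs_iff[OF assms(1,2), of s q]
    by (metis order.order_iff_strict)
qed

text \<open>If the slope between two points exceeded 1 / (1 + \<epsilon>), the straight segment from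
  the earlier to the later one would be a causal curve for \<epsilon>.\<close>

lemma stably_acausal_lipschitz:
  assumes "stably_acausal \<epsilon> A" "(s, p) \<in> A" "(t, q) \<in> A"
  shows "(1 + \<epsilon>) * \<bar>s - t\<bar> \<le> dist p q"
proof (rule ccontr)
  assume gt: "\<not> ?thesis"
  then have ne: "s \<noteq> t" by auto
  show False
  proof (cases "s < t")
    case True
    then have "causally_related \<epsilon> (s, p) (t, q)"
      using gt by (intro causally_related_linepath) (auto simp: dist_norm norm_minus_commute)
    then show False using assms(1)[unfolded stably_acausal_def, rule_format, OF assms(2,3)] ne by simp
  next
    case False
    then have "causally_related \<epsilon> (t, q) (s, p)"
      using gt ne by (intro causally_related_linepath) (auto simp: dist_norm)
    then show False using assms(1)[unfolded stably_acausal_def, rule_format, OF assms(3,2)] ne by simp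
  qed
qed

section \<open>The lower bound\<close>

lemma lightlike_iff: "lightlike v \<longleftrightarrow> v \<noteq> 0 \<and> norm (snd v) = \<bar>fst v\<bar>"
proof -
  have "lorentz_form 0 v v = (norm (snd v))\<^sup>2 - (fst v)\<^sup>2"
    by (simp add: lorentz_form_def power2_norm_eq_inner power2_eq_square[of "fst v"])
  then show ?thesis
    using power2_eq_iff_nonneg[of "norm (snd v)" "\<bar>fst v\<bar>"] by (auto simp: lightlike_def)
qed

lemma norm_lightlike: "lightlike v \<Longrightarrow> norm v = sqrt 2 * \<bar>fst v\<bar>"
  by (auto simp: lightlike_iff norm_prod_def real_sqrt_mult)

lemma lightlike_fst_nonzero: "lightlike v \<Longrightarrow> fst v \<noteq> 0"
  by (auto simp: lightlike_iff prod_eq_iff)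

lemma lightlike_scaleR: "lightlike v \<Longrightarrow> r \<noteq> 0 \<Longrightarrow> lightlike (r *\<^sub>R v)"
  by (auto simp: lightlike_iff abs_mult)

text \<open>Cauchy-Schwarz against the vector (k, 1): the two squared sides differ by the square of
  \<open>k * ?b - ?a\<close>.\<close>

lemma linear_le_sqrt_dist:
  fixes x z :: "'n::finite spacetime"
  shows "k * \<bar>fst x - fst z\<bar> + dist (snd x) (snd z) \<le> sqrt (k\<^sup>2 + 1) * dist x z"
proof -
  let ?a = "\<bar>fst x - fst z\<bar>" and ?b = "dist (snd x) (snd z)"
  have "(k * ?a + ?b)\<^sup>2 \<le> (k\<^sup>2 + 1) * (?a\<^sup>2 + ?b\<^sup>2)"
    using zero_le_power2[of "k * ?b - ?a"] by (simp add: power2_eq_square algebra_simps)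
  then have "k * ?a + ?b \<le> sqrt ((k\<^sup>2 + 1) * (?a\<^sup>2 + ?b\<^sup>2))" by (rule real_le_rsqrt)
  also have "\<dots> = sqrt (k\<^sup>2 + 1) * dist x z"
    by (simp add: real_sqrt_mult dist_prod_def dist_real_def)
  finally show ?thesis .
qed

lemma ereal_between_real:
  assumes "ereal a < f" "f \<le> ereal b"
  obtains r where "f = ereal r" "a < r"
  using assms by (cases f) auto

text \<open>Let h be the climb from \<open>x\<close> to \<open>y\<close> along light. The graph
  passes through \<open>z\<close> and above \<open>y\<close>, and its small slope forces (1 +
  \<epsilon>) (\<open>fst y - fst z\<close>) \<le> h + \<open>dist (snd x) (snd z)\<close>. The left
  side contains (1 + \<epsilon>) h; subtracting the h on the right leaves \<epsilon> h against terms
  in \<open>x\<close> and \<open>z\<close> alone.\<close>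

lemma upper_graph_escape:
  assumes "open \<Omega>" "causally_convex \<Omega>" "stably_acausal \<epsilon> (future_causal_boundary \<Omega>)" "0 \<le> \<epsilon>"
    and z: "z \<in> frontier \<Omega>" "upper_graph \<Omega> (snd z) = ereal (fst z)"
    and y: "y \<in> \<Omega>" "dist (snd x) (snd y) = fst y - fst x"
  shows "\<epsilon> * (fst y - fst x) \<le> sqrt ((1 + \<epsilon>)\<^sup>2 + 1) * dist x z"
proof -
  have gt: "ereal (fst y) < upper_graph \<Omega> (snd y)"
    using between_graphs_iff[OF assms(1,2), of "fst y" "snd y"] y(1) by simp
  \<comment> \<open>The graph is finite at \<open>z\<close>, hence by the Lipschitz property also
    over \<open>y\<close>: this gives a second boundary point to compare with
    \<open>z\<close>.\<close>
  have "upper_graph \<Omega> (snd y) \<le> ereal (fst z + dist (snd y) (snd z))"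
    using upper_graph_lipschitz[of \<Omega> "snd y" "snd z"] z(2) by simp
  then obtain r where r: "upper_graph \<Omega> (snd y) = ereal r" "fst y < r"
    using ereal_between_real[OF gt] by metis
  have "(r, snd y) \<in> future_causal_boundary \<Omega>"
    using y(1) by (intro future_causal_boundaryI assms(1,2) r(1) subsetD[OF closure_subset]) auto
  moreover have "(fst z, snd z) \<in> future_causal_boundary \<Omega>"
    using frontier_on_graphs(1)[OF assms(1,2), of "fst z" "snd z"] z
    by (intro future_causal_boundaryI assms(1,2)) auto
  ultimately have "(1 + \<epsilon>) * \<bar>r - fst z\<bar> \<le> dist (snd y) (snd z)"
    by (rule stably_acausal_lipschitz[OF assms(3)])
  moreover have "(1 + \<epsilon>) * (fst y - fst z) \<le> (1 + \<epsilon>) * \<bar>r - fst z\<bar>"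
    using r(2) assms(4) by (intro mult_left_mono) auto
  ultimately have 1: "(1 + \<epsilon>) * (fst y - fst z) \<le> fst y - fst x + dist (snd x) (snd z)"
    using y(2) dist_triangle[of "snd y" "snd z" "snd x"] dist_commute[of "snd x" "snd y"] by linarith
  have "\<epsilon> * (fst y - fst x) = (1 + \<epsilon>) * (fst y - fst z) - (fst y - fst x) + (1 + \<epsilon>) * (fst z - fst x)"
    by (simp add: algebra_simps)
  also have "\<dots> \<le> dist (snd x) (snd z) + (1 + \<epsilon>) * \<bar>fst x - fst z\<bar>"
    using 1 mult_left_mono[of "fst z - fst x" "\<bar>fst x - fst z\<bar>" "1 + \<epsilon>"] assms(4) by linarith
  also have "\<dots> \<le> sqrt ((1 + \<epsilon>)\<^sup>2 + 1) * dist x z"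
    using linear_le_sqrt_dist[of "1 + \<epsilon>" x z] by simp
  finally show ?thesis .
qed

text \<open>The time reversal of \<open>upper_graph_escape\<close>.\<close>

lemma lower_graph_escape:
  assumes "open \<Omega>" "causally_convex \<Omega>" "stably_acausal \<epsilon> (past_causal_boundary \<Omega>)" "0 \<le> \<epsilon>"
    and z: "z \<in> frontier \<Omega>" "lower_graph \<Omega> (snd z) = ereal (fst z)"
    and y: "y \<in> \<Omega>" "dist (snd x) (snd y) = fst x - fst y"
  shows "\<epsilon> * (fst x - fst y) \<le> sqrt ((1 + \<epsilon>)\<^sup>2 + 1) * dist x z"
proof -
  have gt: "lower_graph \<Omega> (snd y) < ereal (fst y)"
    using between_graphs_iff[OF assms(1,2), of "fst y" "snd y"] y(1) by simp
  have "ereal (fst z) \<le> lower_graph \<Omega> (snd y) + ereal (dist (snd z) (snd y))"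
    using lower_graph_lipschitz[of \<Omega> "snd z" "snd y"] z(2) by simp
  then obtain r where r: "lower_graph \<Omega> (snd y) = ereal r" "r < fst y"
    using gt by (cases "lower_graph \<Omega> (snd y)") auto
  have "(r, snd y) \<in> past_causal_boundary \<Omega>"
    using y(1) by (intro past_causal_boundaryI assms(1,2) r(1) subsetD[OF closure_subset]) auto
  moreover have "(fst z, snd z) \<in> past_causal_boundary \<Omega>"
    using frontier_on_graphs(1)[OF assms(1,2), of "fst z" "snd z"] z
    by (intro past_causal_boundaryI assms(1,2)) auto
  ultimately have "(1 + \<epsilon>) * \<bar>r - fst z\<bar> \<le> dist (snd y) (snd z)"
    by (rule stably_acausal_lipschitz[OF assms(3)])
  moreover have "(1 + \<epsilon>) * (fst z - fst y) \<le> (1 + \<epsilon>) * \<bar>r - fst z\<bar>"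
    using r(2) assms(4) by (intro mult_left_mono) auto
  ultimately have 1: "(1 + \<epsilon>) * (fst z - fst y) \<le> fst x - fst y + dist (snd x) (snd z)"
    using y(2) dist_triangle[of "snd y" "snd z" "snd x"] dist_commute[of "snd x" "snd y"] by linarith
  have "\<epsilon> * (fst x - fst y) = (1 + \<epsilon>) * (fst z - fst y) - (fst x - fst y) + (1 + \<epsilon>) * (fst x - fst z)"
    by (simp add: algebra_simps)
  also have "\<dots> \<le> dist (snd x) (snd z) + (1 + \<epsilon>) * \<bar>fst x - fst z\<bar>"
    using 1 mult_left_mono[of "fst x - fst z" "\<bar>fst x - fst z\<bar>" "1 + \<epsilon>"] assms(4) by linarith
  also have "\<dots> \<le> sqrt ((1 + \<epsilon>)\<^sup>2 + 1) * dist x z"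
    using linear_le_sqrt_dist[of "1 + \<epsilon>" x z] by simp
  finally show ?thesis .
qed

locale stably_acausal_domain =
  fixes \<Omega> :: "'n::finite spacetime set" and \<epsilon> :: real
  assumes domain: "domain \<Omega>" and convex: "causally_convex \<Omega>" and \<epsilon>: "\<epsilon> > 0"
    and future: "stably_acausal \<epsilon> (future_causal_boundary \<Omega>)"
    and past: "stably_acausal \<epsilon> (past_causal_boundary \<Omega>)"
begin

definition C where "C = sqrt ((2 + \<epsilon>)\<^sup>2 + \<epsilon>\<^sup>2) / \<epsilon>"

lemma open_domain: "open \<Omega>"
  using domain unfolding domain_def by blast

lemma C_pos: "0 < C"
  unfolding C_def using \<epsilon> by (intro divide_pos_pos real_sqrt_gt_zero add_pos_pos zero_less_power) auto

text \<open>The factor \<open>sqrt 2\<close> turns the time component of a lightlike vector into its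
  Euclidean length; the other is the Cauchy-Schwarz constant of the escape lemmas.\<close>

lemma C_eq: "C * \<epsilon> = sqrt 2 * sqrt ((1 + \<epsilon>)\<^sup>2 + 1)"
proof -
  have "(2 + \<epsilon>)\<^sup>2 + \<epsilon>\<^sup>2 = 2 * ((1 + \<epsilon>)\<^sup>2 + 1)" by (simp add: power2_eq_square algebra_simps)
  then have "sqrt ((2 + \<epsilon>)\<^sup>2 + \<epsilon>\<^sup>2) = sqrt 2 * sqrt ((1 + \<epsilon>)\<^sup>2 + 1)" by (simp only: real_sqrt_mult)
  then show ?thesis unfolding C_def using \<epsilon> by simp
qed

text \<open>A frontier point on the upper graph constrains the future end of the segment, one on the
  lower graph the past end. Since the infimum runs over both kinds, \<open>m\<close> has to be at
  most \<open>a\<close> and \<open>b\<close>.\<close>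

lemma lightlike_segment_le_infdist_aux:
  assumes "lightlike v" "0 < fst v" "x + a *\<^sub>R v \<in> \<Omega>" "x - b *\<^sub>R v \<in> \<Omega>" "0 \<le> m" "m \<le> a" "m \<le> b"
  shows "m * norm v \<le> C * infdist x (frontier \<Omega>)"
proof -
  have "m * norm v / C \<le> dist x z" if z: "z \<in> frontier \<Omega>" for z
  proof -
    have nv: "norm (snd v) = fst v" using assms(1,2) by (simp add: lightlike_iff)
    have le: "\<epsilon> * (m * fst v) \<le> sqrt ((1 + \<epsilon>)\<^sup>2 + 1) * dist x z"
    proof (cases "upper_graph \<Omega> (snd z) = ereal (fst z)")
      case True
      have "\<epsilon> * (fst (x + a *\<^sub>R v) - fst x) \<le> sqrt ((1 + \<epsilon>)\<^sup>2 + 1) * dist x z"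
        by (rule upper_graph_escape[OF open_domain convex future _ z True assms(3)])
          (use nv \<epsilon> assms in \<open>auto simp: dist_norm\<close>)
      moreover have "\<epsilon> * (m * fst v) \<le> \<epsilon> * (a * fst v)"
        using assms \<epsilon> by (intro mult_left_mono mult_right_mono) auto
      ultimately show ?thesis by simp
    next
      case False
      then have low: "lower_graph \<Omega> (snd z) = ereal (fst z)"
        using frontier_on_graphs(2)[OF open_domain convex, of "fst z" "snd z"] z by simp
      have "\<epsilon> * (fst x - fst (x - b *\<^sub>R v)) \<le> sqrt ((1 + \<epsilon>)\<^sup>2 + 1) * dist x z"
        by (rule lower_graph_escape[OF open_domain convex past _ z low assms(4)])
          (use nv \<epsilon> assms in \<open>auto simp: dist_norm\<close>)
      moreover have "\<epsilon> * (m * fst v) \<le> \<epsilon> * (b * fst v)"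
        using assms \<epsilon> by (intro mult_left_mono mult_right_mono) auto
      ultimately show ?thesis by simp
    qed
    have "\<epsilon> * (m * norm v) = sqrt 2 * (\<epsilon> * (m * fst v))"
      using norm_lightlike[OF assms(1)] assms(2) by simp
    also have "\<dots> \<le> sqrt 2 * (sqrt ((1 + \<epsilon>)\<^sup>2 + 1) * dist x z)"
      using le by (intro mult_left_mono) auto
    also have "\<dots> = \<epsilon> * (C * dist x z)" using C_eq by (simp add: mult_ac)
    finally have "m * norm v \<le> C * dist x z" using \<epsilon> by simp
    then show ?thesis using C_pos by (simp add: divide_le_eq mult.commute)
  qed
  then have "m * norm v / C \<le> infdist x (frontier \<Omega>)"
    unfolding infdist_def using domain_frontier_nonempty[OF domain] by (auto intro!: cINF_greatest)
  then show ?thesis using C_pos by (simp add: divide_le_eq mult.commute)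
qed

lemma lightlike_segment_le_infdist:
  assumes "lightlike v" "x + a *\<^sub>R v \<in> \<Omega>" "x - b *\<^sub>R v \<in> \<Omega>" "0 \<le> m" "m \<le> a" "m \<le> b"
  shows "m * norm v \<le> C * infdist x (frontier \<Omega>)"
proof (cases "0 < fst v")
  case False
  then have "0 < fst (- v)" "lightlike (- v)"
    using lightlike_fst_nonzero[OF assms(1)] lightlike_scaleR[OF assms(1), of "-1"] by auto
  \<comment> \<open>Reversing \<open>v\<close> exchanges the two ends, so \<open>a\<close> and
    \<open>b\<close> trade places.\<close>
  then show ?thesis
    using lightlike_segment_le_infdist_aux[of "- v" x b a m] assms by simp
qed (use lightlike_segment_le_infdist_aux assms in blast)

end

section \<open>Homographies of the interval\<close>

lemma homography_denominator_pos:
  fixes c d :: real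
  assumes "\<And>s. s \<in> {-1<..<1} \<Longrightarrow> c * s + d \<noteq> 0" "0 < d" "s \<in> {-1<..<1}"
  shows "0 < c * s + d"
proof (rule ccontr)
  assume "\<not> ?thesis"
  \<comment> \<open>A sign change would place the root -d / c in the interval, because d \<le> |c s|
    < |c|.\<close>
  then have "c * s \<le> - d" by simp
  then have "d \<le> \<bar>c * s\<bar>" "c \<noteq> 0" using assms(2) by auto
  have "\<bar>s\<bar> < 1" using assms(3) by auto
  then have "\<bar>c * s\<bar> < \<bar>c\<bar>" using \<open>c \<noteq> 0\<close> by (simp add: abs_mult)
  define r where "r = - d / c"
  have "\<bar>r\<bar> < 1" using \<open>d \<le> \<bar>c * s\<bar>\<close> \<open>\<bar>c * s\<bar> < \<bar>c\<bar>\<close> assms(2)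
    by (simp add: r_def divide_less_eq)
  then have "r \<in> {-1<..<1}" by auto
  from assms(1)[OF this] show False using \<open>c \<noteq> 0\<close> by (simp add: r_def)
qed

text \<open>Two independent sign choices: multiplying all four coefficients by \<open>sgn d\<close>
  leaves the homography unchanged and makes the denominator positive; reversing both the numerator
  and \<open>v\<close> leaves the curve unchanged and flips the determinant.\<close>

lemma projective_lightlike_geodesic_normal_form:
  assumes "projective_lightlike_geodesic \<Omega> \<gamma>"
  obtains x v a b c d where "lightlike v" "a * d - b * c > 0"
    "\<And>s. s \<in> {-1<..<1} \<Longrightarrow> c * s + d > 0"
    "\<And>s. s \<in> {-1<..<1} \<Longrightarrow> \<gamma> s = x + ((a * s + b) / (c * s + d)) *\<^sub>R v"
    "\<And>s. s \<in> {-1<..<1} \<Longrightarrow> \<gamma> s \<in> \<Omega>"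
proof -
  obtain x v a b c d where v: "lightlike v" and det: "a * d - b * c \<noteq> 0"
    and \<gamma>: "\<And>s. s \<in> {-1<..<1} \<Longrightarrow> c * s + d \<noteq> 0 \<and> \<gamma> s = x + ((a * s + b) / (c * s + d)) *\<^sub>R v \<and> \<gamma> s \<in> \<Omega>"
    using assms unfolding projective_lightlike_geodesic_def by blast
  define \<sigma> where "\<sigma> = sgn d"
  define \<tau> where "\<tau> = sgn (a * d - b * c)"
  have "d \<noteq> 0" using \<gamma>[of 0] by simp
  then have \<sigma>: "\<sigma> * \<sigma> = 1" "0 < \<sigma> * d" "\<sigma> \<noteq> 0" by (auto simp: \<sigma>_def sgn_if)
  have \<tau>: "\<tau> * \<tau> = 1" "0 < \<tau> * (a * d - b * c)" "\<tau> \<noteq> 0" using det by (auto simp: \<tau>_def sgn_if)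
  show ?thesis
  proof (rule that)
    show "lightlike (\<tau> *\<^sub>R v)" using v \<tau>(3) by (rule lightlike_scaleR)
    have "(\<tau> * \<sigma> * a) * (\<sigma> * d) - (\<tau> * \<sigma> * b) * (\<sigma> * c) = (\<sigma> * \<sigma>) * (\<tau> * (a * d - b * c))"
      by (simp add: algebra_simps)
    then show "0 < (\<tau> * \<sigma> * a) * (\<sigma> * d) - (\<tau> * \<sigma> * b) * (\<sigma> * c)" using \<sigma>(1) \<tau>(2) by simp
    have eq: "\<sigma> * c * s + \<sigma> * d = \<sigma> * (c * s + d)" for s by (simp add: algebra_simps)
    show "0 < \<sigma> * c * s + \<sigma> * d" if "s \<in> {-1<..<1}" for s
      using \<gamma> \<sigma>(2,3) that by (intro homography_denominator_pos) (auto simp: eq)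
    show "\<gamma> s = x + ((\<tau> * \<sigma> * a * s + \<tau> * \<sigma> * b) / (\<sigma> * c * s + \<sigma> * d)) *\<^sub>R \<tau> *\<^sub>R v"
      if "s \<in> {-1<..<1}" for s
    proof -
      have "\<tau> * \<sigma> * a * s + \<tau> * \<sigma> * b = \<tau> * \<sigma> * (a * s + b)" by (simp add: algebra_simps)
      then have "(\<tau> * \<sigma> * a * s + \<tau> * \<sigma> * b) / (\<sigma> * c * s + \<sigma> * d) * \<tau>
          = (\<tau> * \<tau>) * ((a * s + b) / (c * s + d))"
        using \<sigma>(3) by (simp add: eq)
      then show ?thesis using \<tau>(1) \<gamma>[OF that] by simp
    qed
    show "\<gamma> s \<in> \<Omega>" if "s \<in> {-1<..<1}" for s using \<gamma>[OF that] by blast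
  qed
qed

lemma homography_diff:
  fixes a b c d :: real
  assumes "c * s + d \<noteq> 0" "c * w + d \<noteq> 0"
  shows "(a * w + b) / (c * w + d) - (a * s + b) / (c * s + d)
    = (a * d - b * c) * (w - s) / ((c * w + d) * (c * s + d))"
  using assms by (simp add: diff_frac_eq) (simp add: algebra_simps)

context stably_acausal_domain
begin

text \<open>Nothing is known at the parameters 1 and -1: the denominator may vanish there and the
  curve may leave \<open>\<Omega>\<close>. The segment estimate is therefore applied between the
  interior parameters \<eta> and -\<eta>.\<close>

lemma homography_speed_le_infdist:
  fixes a b c d :: real
  assumes v: "lightlike v" and det: "a * d - b * c > 0"
    and den: "\<And>s. s \<in> {-1<..<1} \<Longrightarrow> c * s + d > 0"
    and \<gamma>: "\<And>s. s \<in> {-1<..<1} \<Longrightarrow> \<gamma> s = x + ((a * s + b) / (c * s + d)) *\<^sub>R v"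
    and in\<Omega>: "\<And>s. s \<in> {-1<..<1} \<Longrightarrow> \<gamma> s \<in> \<Omega>"
    and s: "s \<in> {-1<..<1}"
  shows "(a * d - b * c) / (c * s + d)\<^sup>2 * ((1 - s\<^sup>2) / 2) * norm v \<le> C * infdist (\<gamma> s) (frontier \<Omega>)"
proof -
  let ?\<Delta> = "a * d - b * c" and ?q = "\<lambda>s. c * s + d"
  have le: "?\<Delta> / (?q s)\<^sup>2 * ((\<eta>\<^sup>2 - s\<^sup>2) / (2 * \<eta>)) * norm v \<le> C * infdist (\<gamma> s) (frontier \<Omega>)"
    if \<eta>: "\<bar>s\<bar> < \<eta>" "\<eta> < 1" for \<eta>
  proof -
    have I: "\<eta> \<in> {-1<..<1}" "-\<eta> \<in> {-1<..<1}" "0 < \<eta>" using \<eta> by auto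
    have q: "0 < ?q s" "0 < ?q \<eta>" "0 < d - c * \<eta>" using den[OF s] den[OF I(1)] den[OF I(2)] by auto
    \<comment> \<open>The parameters \<open>\<plusminus>\<eta>\<close> are reached at distances \<open>\<tau>1\<close>, \<open>\<tau>2\<close> along \<open>v\<close>; both are at least \<open>m\<close>,
      which tends to the required bound as \<open>\<eta>\<close> tends to 1.\<close>
    define m where "m = ?\<Delta> / (?q s)\<^sup>2 * ((\<eta>\<^sup>2 - s\<^sup>2) / (2 * \<eta>))"
    define \<tau>1 where "\<tau>1 = ?\<Delta> * (\<eta> - s) / (?q \<eta> * ?q s)"
    define \<tau>2 where "\<tau>2 = ?\<Delta> * (\<eta> + s) / ((d - c * \<eta>) * ?q s)"
    have "\<gamma> s + \<tau>1 *\<^sub>R v = \<gamma> \<eta>"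
    proof -
      have "(a * \<eta> + b) / ?q \<eta> = (a * s + b) / ?q s + \<tau>1"
        using homography_diff[of c s d \<eta> a b] q by (simp add: \<tau>1_def)
      then show ?thesis by (simp only: \<gamma>[OF s] \<gamma>[OF I(1)] scaleR_add_left add.assoc)
    qed
    moreover have "\<gamma> s - \<tau>2 *\<^sub>R v = \<gamma> (-\<eta>)"
    proof -
      have "(a * - \<eta> + b) / (c * - \<eta> + d) = (a * s + b) / (c * s + d) - \<tau>2"
      proof -
        have "(a * - \<eta> + b) / (c * - \<eta> + d) - (a * s + b) / (c * s + d)
            = (a * d - b * c) * (- \<eta> - s) / ((c * - \<eta> + d) * (c * s + d))"
          using q by (intro homography_diff) auto
        also have "(a * d - b * c) * (- \<eta> - s) = - (?\<Delta> * (\<eta> + s))" by (simp add: algebra_simps)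
        also have "c * - \<eta> + d = d - c * \<eta>" by simp
        finally show ?thesis by (simp add: \<tau>2_def)
      qed
      then show ?thesis by (simp only: \<gamma>[OF s] \<gamma>[OF I(2)] scaleR_diff_left) simp
    qed
    moreover have "0 \<le> m"
      unfolding m_def using det \<eta> I
      by (intro mult_nonneg_nonneg divide_nonneg_nonneg) (auto simp: abs_le_square_iff[symmetric])
    moreover have "m \<le> \<tau>1"
    proof -
      \<comment> \<open>In fact 1 / m = 1 / \<tau>1 + 1 / \<tau>2, and each of the two bounds drops
        one positive term. Here the dropped term is (d - c \<eta>) (\<eta> - s).\<close>
      have "(\<eta> + s) * ?q \<eta> \<le> 2 * \<eta> * ?q s"
        using mult_nonneg_nonneg[of "d - c * \<eta>" "\<eta> - s"] q \<eta> by (simp add: algebra_simps)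
      then have "?\<Delta> * (\<eta> - s) * ((\<eta> + s) * ?q \<eta>) \<le> ?\<Delta> * (\<eta> - s) * (2 * \<eta> * ?q s)"
        using det \<eta> by (intro mult_left_mono) auto
      then show ?thesis
        unfolding m_def \<tau>1_def using q I
        by (simp add: divide_simps power2_eq_square) (simp add: algebra_simps)
    qed
    moreover have "m \<le> \<tau>2"
    proof -
      have "(\<eta> - s) * (d - c * \<eta>) \<le> 2 * \<eta> * ?q s"
        using mult_nonneg_nonneg[of "?q \<eta>" "\<eta> + s"] q \<eta> by (simp add: algebra_simps)
      then have "?\<Delta> * (\<eta> + s) * ((\<eta> - s) * (d - c * \<eta>)) \<le> ?\<Delta> * (\<eta> + s) * (2 * \<eta> * ?q s)"
        using det \<eta> by (intro mult_left_mono) auto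
      then show ?thesis
        unfolding m_def \<tau>2_def using q I
        by (simp add: divide_simps power2_eq_square) (simp add: algebra_simps)
    qed
    ultimately have "m * norm v \<le> C * infdist (\<gamma> s) (frontier \<Omega>)"
      using lightlike_segment_le_infdist[OF v, of "\<gamma> s" \<tau>1 \<tau>2 m] in\<Omega> I by metis
    then show ?thesis unfolding m_def .
  qed
  have s1: "\<bar>s\<bar> < 1" using s by auto
  have lim: "((\<lambda>\<eta>. ?\<Delta> / (?q s)\<^sup>2 * ((\<eta>\<^sup>2 - s\<^sup>2) / (2 * \<eta>)) * norm v)
      \<longlongrightarrow> ?\<Delta> / (?q s)\<^sup>2 * ((1\<^sup>2 - s\<^sup>2) / (2 * 1)) * norm v) (at_left 1)"
    using den[OF s] by (intro tendsto_intros) auto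
  have ev: "\<forall>\<^sub>F \<eta> in at_left 1. ?\<Delta> / (?q s)\<^sup>2 * ((\<eta>\<^sup>2 - s\<^sup>2) / (2 * \<eta>)) * norm v
        \<le> C * infdist (\<gamma> s) (frontier \<Omega>)"
  proof (rule eventually_at_leftI[OF _ s1])
    fix \<eta> assume "\<eta> \<in> {\<bar>s\<bar><..<1}"
    then have "\<bar>s\<bar> < \<eta>" "\<eta> < 1" by auto
    then show "?\<Delta> / (?q s)\<^sup>2 * ((\<eta>\<^sup>2 - s\<^sup>2) / (2 * \<eta>)) * norm v \<le> C * infdist (\<gamma> s) (frontier \<Omega>)"
      by (rule le)
  qed
  show ?thesis
    using tendsto_upperbound[OF lim ev trivial_limit_at_left_real] by (simp only: power_one mult_1_right)
qed

end

text \<open>Writes \<open>rho_I\<close> as a difference of values of ln (1 + r) - ln (1 - r), the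
  primitive of the density 2 / (1 - r^2); this is what makes it computable by integration.\<close>

lemma rho_I_eq:
  assumes "s \<in> {-1<..<1}" "t \<in> {-1<..<1}"
  shows "rho_I s t = \<bar>(ln (1 + t) - ln (1 - t)) - (ln (1 + s) - ln (1 - s))\<bar>"
proof -
  have pos: "0 < 1 + s" "0 < 1 - s" "0 < 1 + t" "0 < 1 - t" using assms by auto
  have "(s - 1) * (t + 1) = - ((1 + t) * (1 - s))" "(s + 1) * (t - 1) = - ((1 - t) * (1 + s))"
    by algebra+
  then have "rho_I s t = \<bar>ln (((1 + t) * (1 - s)) / ((1 - t) * (1 + s)))\<bar>"
    unfolding rho_I_def by (simp only: minus_divide_divide)
  also have "ln (((1 + t) * (1 - s)) / ((1 - t) * (1 + s))) = ln ((1 + t) * (1 - s)) - ln ((1 - t) * (1 + s))"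
    using pos by (simp add: ln_divide_pos)
  also have "\<dots> = (ln (1 + t) + ln (1 - s)) - (ln (1 - t) + ln (1 + s))"
    using pos by (simp add: ln_mult_pos)
  finally show ?thesis by (simp add: algebra_simps)
qed

section \<open>Quasi-hyperbolic length of geodesics and chains\<close>

context stably_acausal_domain
begin

text \<open>The competing curve is the geodesic itself between the two parameters, affinely
  reparametrized. Its quasi-hyperbolic speed is at most \<open>C\<close> times the pulled-back
  density 2 / (1 - r^2).\<close>

lemma quasihyperbolic_reach_geodesic:
  assumes "projective_lightlike_geodesic \<Omega> \<gamma>" and s: "s \<in> {-1<..<1}" and t: "t \<in> {-1<..<1}"
  shows "quasihyperbolic_reach \<Omega> (\<gamma> s) (\<gamma> t) (C * rho_I s t)"
proof -
  obtain x v a b c d where v: "lightlike v" and det: "a * d - b * c > 0"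
    and den: "\<And>s. s \<in> {-1<..<1} \<Longrightarrow> c * s + d > 0"
    and \<gamma>: "\<And>s. s \<in> {-1<..<1} \<Longrightarrow> \<gamma> s = x + ((a * s + b) / (c * s + d)) *\<^sub>R v"
    and in\<Omega>: "\<And>s. s \<in> {-1<..<1} \<Longrightarrow> \<gamma> s \<in> \<Omega>"
    using projective_lightlike_geodesic_normal_form[OF assms(1)] by metis
  let ?q = "\<lambda>s. c * s + d" and ?\<Delta> = "a * d - b * c"
  define w where "w = (\<lambda>u. (t - s) * u + s)"
  define \<sigma> where "\<sigma> = (\<lambda>u. \<gamma> (w u))"
  have w_between: "w u \<in> {min s t..max s t}" if "u \<in> {0..1}" for u
  proof -
    have eq: "w u = (1 - u) * s + u * t" by (simp add: w_def algebra_simps)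
    have "(1 - u) * min s t + u * min s t \<le> w u" "w u \<le> (1 - u) * max s t + u * max s t"
      unfolding eq using that by (auto intro!: add_mono mult_left_mono)
    then show ?thesis by (simp add: algebra_simps)
  qed
  have sub: "{min s t..max s t} \<subseteq> {-1<..<1}" using s t by auto
  have w: "w u \<in> {-1<..<1}" if "u \<in> {0..1}" for u using w_between[OF that] sub by blast
  \<comment> \<open>\<open>\<gamma>\<close> is determined only inside the open interval, so
    smoothness is proved for the formula and then carried over.\<close>
  have "smooth_curve_on (min s t) (max s t) (\<lambda>t. x + ((a * t + b) / (c * t + d)) *\<^sub>R v)"
    using den sub by (intro smooth_curve_on_homography) force
  from smooth_curve_on_affine[OF this, of 0 1 "t - s" s]
  have "smooth_curve_on 0 1 (\<lambda>u. x + ((a * w u + b) / (c * w u + d)) *\<^sub>R v)"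
    using w_between by (simp add: w_def)
  then have "smooth_curve_on 0 1 \<sigma>"
    by (rule smooth_curve_on_cong) (simp only: \<sigma>_def \<gamma>[OF w])
  then have smooth: "piecewise_smooth_curve \<sigma>"
    unfolding piecewise_smooth_curve_def using smooth_subdivision_1 by blast
  have img: "\<sigma> ` {0..1} \<subseteq> \<Omega>" using in\<Omega> w by (auto simp: \<sigma>_def)
  have vd: "vector_derivative \<sigma> (at u within {0..1}) = ((t - s) * (?\<Delta> / (?q (w u))\<^sup>2)) *\<^sub>R v"
    if u: "u \<in> {0..1}" for u
  proof (rule vector_derivative_within_closed_interval[OF _ u])
    have "?q (w u) \<noteq> 0" using den[OF w[OF u]] by simp
    then have "((\<lambda>u. (a * w u + b) / (c * w u + d)) has_real_derivative (t - s) * (?\<Delta> / (?q (w u))\<^sup>2))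
        (at u within {0..1})"
      unfolding w_def
      by (auto intro!: derivative_eq_intros simp: power2_eq_square) (simp add: algebra_simps add_divide_distrib diff_divide_distrib)
    from has_vector_derivative_add[OF has_vector_derivative_const[of x]
        has_vector_derivative_scaleR[OF this has_vector_derivative_const[of v]]]
    have "((\<lambda>u. x + ((a * w u + b) / (c * w u + d)) *\<^sub>R v) has_vector_derivative
        ((t - s) * (?\<Delta> / (?q (w u))\<^sup>2)) *\<^sub>R v) (at u within {0..1})"
      by simp
    then show "(\<sigma> has_vector_derivative ((t - s) * (?\<Delta> / (?q (w u))\<^sup>2)) *\<^sub>R v) (at u within {0..1})"
      by (rule has_vector_derivative_transform[OF u, rotated]) (simp only: \<sigma>_def \<gamma>[OF w])
  qed simp
  define A where "A = (\<lambda>r::real. ln (1 + r) - ln (1 - r))"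
  define f where "f = (\<lambda>u. norm (vector_derivative \<sigma> (at u within {0..1})) / infdist (\<sigma> u) (frontier \<Omega>))"
  \<comment> \<open>\<open>sgn (t - s) * (t - s)\<close> is the absolute value needed for a speed.
    Kept in this form, what follows the sign is the derivative of \<open>A (w u)\<close>, whichever
    of \<open>s\<close> and \<open>t\<close> is larger.\<close>
  define g where "g = (\<lambda>u. C * (sgn (t - s) * ((t - s) * (2 / (1 - (w u)\<^sup>2)))))"
  have "f u \<le> g u" if u: "u \<in> {0..1}" for u
  proof -
    have lt: "(w u)\<^sup>2 < 1" using w[OF u] by (simp add: abs_square_less_1 abs_less_iff)
    have dpos: "0 < infdist (\<sigma> u) (frontier \<Omega>)"
      using infdist_frontier_pos[OF domain, of "\<sigma> u"] img u by blast
    have "?\<Delta> / (?q (w u))\<^sup>2 * ((1 - (w u)\<^sup>2) / 2) * norm v \<le> C * infdist (\<sigma> u) (frontier \<Omega>)"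
      using homography_speed_le_infdist[OF v det den \<gamma> in\<Omega> w[OF u]] by (simp add: \<sigma>_def)
    then have bound: "(?\<Delta> / (?q (w u))\<^sup>2 * norm v) * ((1 - (w u)\<^sup>2) / 2) \<le> C * infdist (\<sigma> u) (frontier \<Omega>)"
      by (simp only: mult_ac)
    have "S / i \<le> C * (2 / (1 - p))" if "S * ((1 - p) / 2) \<le> C * i" "p < 1" "0 < i" for S i p :: real
    proof -
      have "S = S * ((1 - p) / 2) * (2 / (1 - p))" using that(2) by simp
      also have "\<dots> \<le> C * i * (2 / (1 - p))" using that by (intro mult_right_mono) auto
      finally show ?thesis using that(3) by (simp add: pos_divide_le_eq mult_ac)
    qed
    from this[OF bound lt dpos]
    have "?\<Delta> / (?q (w u))\<^sup>2 * norm v / infdist (\<sigma> u) (frontier \<Omega>) \<le> C * (2 / (1 - (w u)\<^sup>2))"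
      .
    then have "\<bar>t - s\<bar> * (?\<Delta> / (?q (w u))\<^sup>2 * norm v / infdist (\<sigma> u) (frontier \<Omega>))
        \<le> \<bar>t - s\<bar> * (C * (2 / (1 - (w u)\<^sup>2)))"
      by (rule mult_left_mono) simp
    moreover have "f u = \<bar>t - s\<bar> * (?\<Delta> / (?q (w u))\<^sup>2 * norm v / infdist (\<sigma> u) (frontier \<Omega>))"
      using det unfolding f_def vd[OF u] by (simp add: abs_mult)
    moreover have "g u = \<bar>t - s\<bar> * (C * (2 / (1 - (w u)\<^sup>2)))"
      unfolding g_def by (simp add: abs_sgn)
    ultimately show ?thesis by simp
  qed
  moreover have "f integrable_on {0..1}"
    unfolding f_def by (rule quasihyperbolic_integrable[OF domain smooth img])
  moreover have g: "(g has_integral C * (sgn (t - s) * (A t - A s))) {0..1}"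
  proof -
    have "((\<lambda>u. (t - s) * (2 / (1 - (w u)\<^sup>2))) has_integral (A (w 1) - A (w 0))) {0..1}"
    proof (rule fundamental_theorem_of_calculus)
      fix u :: real assume u: "u \<in> {0..1}"
      have pos: "1 + w u > 0" "1 - w u > 0" using w[OF u] by auto
      have "(w has_real_derivative (t - s)) (at u within {0..1})"
        unfolding w_def by (auto intro!: derivative_eq_intros)
      then have "((\<lambda>u. A (w u)) has_real_derivative (t - s) * (1 / (1 + w u) + 1 / (1 - w u))) (at u within {0..1})"
        unfolding A_def using pos
        by (auto intro!: derivative_eq_intros simp: algebra_simps add_divide_distrib diff_divide_distrib)
      moreover have "1 / (1 + w u) + 1 / (1 - w u) = 2 / (1 - (w u)\<^sup>2)"
        using pos by (simp add: add_frac_eq) (simp add: power2_eq_square algebra_simps)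
      ultimately have "((\<lambda>u. A (w u)) has_real_derivative (t - s) * (2 / (1 - (w u)\<^sup>2))) (at u within {0..1})"
        by simp
      then show "((\<lambda>u. A (w u)) has_vector_derivative (t - s) * (2 / (1 - (w u)\<^sup>2))) (at u within {0..1})"
        by (simp add: has_real_derivative_iff_has_vector_derivative)
    qed simp
    then show ?thesis
      unfolding g_def by (intro has_integral_mult_right) (simp add: w_def)
  qed
  ultimately have "quasihyperbolic_length \<Omega> \<sigma> \<le> C * (sgn (t - s) * (A t - A s))"
    unfolding quasihyperbolic_length_def f_def[symmetric]
    using integral_le[of f "{0..1}" g] by (auto simp: integral_unique has_integral_integrable)
  also have "\<dots> \<le> C * rho_I s t"
    using C_pos unfolding rho_I_eq[OF s t] A_def
    by (intro mult_left_mono) (auto simp: sgn_if)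
  finally show ?thesis
    using smooth img unfolding quasihyperbolic_reach_def
    by (intro exI[of _ \<sigma>]) (simp add: \<sigma>_def w_def)
qed

lemma quasihyperbolic_reach_chain:
  assumes "markowitz_chain \<Omega> x y m \<gamma> s t"
  shows "quasihyperbolic_reach \<Omega> x y (C * (\<Sum>k=1..m. rho_I (s k) (t k)))"
proof -
  have geo: "quasihyperbolic_reach \<Omega> (\<gamma> k (s k)) (\<gamma> k (t k)) (C * rho_I (s k) (t k))" if "k \<in> {1..m}" for k
    using assms that unfolding markowitz_chain_def by (intro quasihyperbolic_reach_geodesic) auto
  have "1 \<le> m" using assms unfolding markowitz_chain_def by simp
  have "quasihyperbolic_reach \<Omega> x (\<gamma> j (t j)) (C * (\<Sum>k=1..j. rho_I (s k) (t k)))"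
    if "1 \<le> j" "j \<le> m" for j
    using that
  proof (induction j rule: dec_induct)
    case base
    then show ?case using geo[of 1] assms unfolding markowitz_chain_def by simp
  next
    case (step j)
    have "\<gamma> j (t j) = \<gamma> (Suc j) (s (Suc j))"
      using assms step unfolding markowitz_chain_def by simp
    then have "quasihyperbolic_reach \<Omega> x (\<gamma> (Suc j) (t (Suc j)))
        (C * (\<Sum>k=1..j. rho_I (s k) (t k)) + C * rho_I (s (Suc j)) (t (Suc j)))"
      using step geo[of "Suc j"] by (intro quasihyperbolic_reach_trans[OF domain]) auto
    then show ?case using step by (simp add: algebra_simps)
  qed
  from this[OF \<open>1 \<le> m\<close> order_refl] show ?thesis using assms unfolding markowitz_chain_def by simp
qed

lemma quasihyperbolic_dist_le_markowitz_dist: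
  "ennreal (\<epsilon> / sqrt ((2 + \<epsilon>)\<^sup>2 + \<epsilon>\<^sup>2)) * quasihyperbolic_dist \<Omega> x y \<le> markowitz_dist \<Omega> x y"
  unfolding markowitz_dist_def
proof (rule Inf_greatest)
  let ?c = "\<epsilon> / sqrt ((2 + \<epsilon>)\<^sup>2 + \<epsilon>\<^sup>2)"
  have c: "0 \<le> ?c" "?c * C = 1" using \<epsilon> C_pos unfolding C_def by (auto simp: divide_simps)
  fix e assume "e \<in> {ennreal (\<Sum>k=1..m. rho_I (s k) (t k)) | m \<gamma> s t. markowitz_chain \<Omega> x y m \<gamma> s t}"
  then obtain m \<gamma> s t where e: "e = ennreal (\<Sum>k=1..m. rho_I (s k) (t k))"
    and "markowitz_chain \<Omega> x y m \<gamma> s t"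
    by blast
  then have "quasihyperbolic_dist \<Omega> x y \<le> ennreal (C * (\<Sum>k=1..m. rho_I (s k) (t k)))"
    using quasihyperbolic_dist_le quasihyperbolic_reach_chain by blast
  then have "ennreal ?c * quasihyperbolic_dist \<Omega> x y
      \<le> ennreal ?c * ennreal (C * (\<Sum>k=1..m. rho_I (s k) (t k)))"
    by (rule mult_left_mono) simp
  also have "\<dots> = ennreal (?c * (C * (\<Sum>k=1..m. rho_I (s k) (t k))))"
    using ennreal_mult'[OF c(1)] by simp
  also have "?c * (C * (\<Sum>k=1..m. rho_I (s k) (t k))) = (\<Sum>k=1..m. rho_I (s k) (t k))"
    using c(2) by (simp only: mult.assoc[symmetric] mult_1)
  finally show "ennreal ?c * quasihyperbolic_dist \<Omega> x y \<le> e" unfolding e .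
qed

end

section \<open>The upper bound\<close>

definition markowitz_reach where
  "markowitz_reach \<Omega> x y l \<longleftrightarrow>
     (\<exists>m \<gamma> s t. markowitz_chain \<Omega> x y m \<gamma> s t \<and> (\<Sum>k=1..m. rho_I (s k) (t k)) \<le> l)"

lemma markowitz_dist_le:
  assumes "markowitz_reach \<Omega> x y l"
  shows "markowitz_dist \<Omega> x y \<le> ennreal l"
proof -
  obtain m \<gamma> s t where 1: "markowitz_chain \<Omega> x y m \<gamma> s t" and 2: "(\<Sum>k=1..m. rho_I (s k) (t k)) \<le> l"
    using assms unfolding markowitz_reach_def by blast
  have "markowitz_dist \<Omega> x y \<le> ennreal (\<Sum>k=1..m. rho_I (s k) (t k))"
    unfolding markowitz_dist_def using 1 by (intro Inf_lower) blast
  also have "\<dots> \<le> ennreal l" using 2 by (rule ennreal_leI)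
  finally show ?thesis .
qed

lemma markowitz_reach_mono: "markowitz_reach \<Omega> x y l \<Longrightarrow> l \<le> l' \<Longrightarrow> markowitz_reach \<Omega> x y l'"
  unfolding markowitz_reach_def by (meson order_trans)

text \<open>Chains are indexed from 1, so entry k of the second one moves to m + k; at the seam
  \<open>k = m\<close> both sides of the matching condition are \<open>y\<close>.\<close>

lemma markowitz_chain_append:
  fixes \<gamma> \<gamma>' :: "nat \<Rightarrow> real \<Rightarrow> 'n::finite spacetime" and s s' t t' :: "nat \<Rightarrow> real" and m m' :: nat
  defines "app \<equiv> \<lambda>(f :: nat \<Rightarrow> real) f' k. if k \<le> m then f k else f' (k - m)"
  assumes c: "markowitz_chain \<Omega> x y m \<gamma> s t" and c': "markowitz_chain \<Omega> y z m' \<gamma>' s' t'"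
  shows "markowitz_chain \<Omega> x z (m + m') (\<lambda>k. if k \<le> m then \<gamma> k else \<gamma>' (k - m)) (app s s') (app t t')"
  unfolding markowitz_chain_def
proof (intro conjI ballI)
  have m: "1 \<le> m" "1 \<le> m'" using c c' unfolding markowitz_chain_def by blast+
  let ?\<gamma> = "\<lambda>k. if k \<le> m then \<gamma> k else \<gamma>' (k - m)"
  show "1 \<le> m + m'" using m by simp
  show "?\<gamma> 1 (app s s' 1) = x" using c m unfolding markowitz_chain_def by (simp add: app_def)
  show "?\<gamma> (m + m') (app t t' (m + m')) = z"
    using c' m unfolding markowitz_chain_def by (simp add: app_def)
  fix k
  show "projective_lightlike_geodesic \<Omega> (?\<gamma> k)" "app s s' k \<in> {-1<..<1}" "app t t' k \<in> {-1<..<1}"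
    if k: "k \<in> {1..m + m'}"
  proof -
    have "k \<le> m \<and> k \<in> {1..m} \<or> \<not> k \<le> m \<and> k - m \<in> {1..m'}" using k by auto
    then show "projective_lightlike_geodesic \<Omega> (?\<gamma> k)" "app s s' k \<in> {-1<..<1}" "app t t' k \<in> {-1<..<1}"
      using c c' unfolding markowitz_chain_def app_def by (smt (verit))+
  qed
  show "?\<gamma> k (app t t' k) = ?\<gamma> (k + 1) (app s s' (k + 1))" if k: "k \<in> {1..<m + m'}"
  proof -
    consider "k < m" | "k = m" | "m < k" by linarith
    then show ?thesis
    proof cases
      case 1
      then have "\<gamma> k (t k) = \<gamma> (k + 1) (s (k + 1))" using c k unfolding markowitz_chain_def by simp
      then show ?thesis using 1 by (simp add: app_def)
    next
      case 2
      then show ?thesis using c c' unfolding markowitz_chain_def by (simp add: app_def)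
    next
      case 3
      then have "k - m \<in> {1..<m'}" using k by auto
      then have "\<gamma>' (k - m) (t' (k - m)) = \<gamma>' (k - m + 1) (s' (k - m + 1))"
        using c' unfolding markowitz_chain_def by blast
      moreover have "k + 1 - m = k - m + 1" using 3 by simp
      ultimately show ?thesis using 3 by (simp add: app_def)
    qed
  qed
qed

lemma markowitz_reach_trans:
  assumes "markowitz_reach \<Omega> x y l" "markowitz_reach \<Omega> y z l'"
  shows "markowitz_reach \<Omega> x z (l + l')"
proof -
  obtain m \<gamma> s t where c: "markowitz_chain \<Omega> x y m \<gamma> s t" and le: "(\<Sum>k=1..m. rho_I (s k) (t k)) \<le> l"
    using assms(1) unfolding markowitz_reach_def by blast
  obtain m' \<gamma>' s' t' where c': "markowitz_chain \<Omega> y z m' \<gamma>' s' t'"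
    and le': "(\<Sum>k=1..m'. rho_I (s' k) (t' k)) \<le> l'"
    using assms(2) unfolding markowitz_reach_def by blast
  let ?app = "\<lambda>(f :: nat \<Rightarrow> real) f' k. if k \<le> m then f k else f' (k - m)"
  let ?r = "\<lambda>k. rho_I (?app s s' k) (?app t t' k)"
  have "{1..m + m'} = {1..m} \<union> {1 + m..m' + m}" by auto
  then have "(\<Sum>k=1..m + m'. ?r k) = (\<Sum>k=1..m. ?r k) + (\<Sum>k=1 + m..m' + m. ?r k)"
    by (simp only:) (rule sum.union_disjoint; auto)
  also have "(\<Sum>k=1 + m..m' + m. ?r k) = (\<Sum>k=1..m'. ?r (k + m))"
    by (rule sum.shift_bounds_cl_nat_ivl)
  also have "\<dots> = (\<Sum>k=1..m'. rho_I (s' k) (t' k))" by (rule sum.cong) auto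
  also have "(\<Sum>k=1..m. ?r k) = (\<Sum>k=1..m. rho_I (s k) (t k))" by (rule sum.cong) auto
  finally have "(\<Sum>k=1..m + m'. ?r k) \<le> l + l'" using le le' by simp
  then show ?thesis
    using markowitz_chain_append[OF c c'] unfolding markowitz_reach_def by blast
qed

section \<open>Short steps inside a ball\<close>

lemma abs_ln_ratio_le:
  fixes r :: real
  assumes "\<bar>r\<bar> < 1"
  shows "\<bar>ln (1 + r) - ln (1 - r)\<bar> \<le> 2 * \<bar>r\<bar> / (1 - \<bar>r\<bar>)"
proof -
  have *: "\<bar>ln (1 + a) - ln (1 - a)\<bar> \<le> 2 * a / (1 - a)" if "0 \<le> a" "a < 1" for a :: real
  proof -
    \<comment> \<open>Both logarithms are bounded by a / (1 - a), the second through ln z \<le> z -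
      1 at z = 1 / (1 - a).\<close>
    have "ln (1 + a) \<le> a" using that by (simp add: ln_add_one_self_le_self)
    moreover have "- ln (1 - a) = ln (1 / (1 - a))" using that by (simp add: ln_divide_pos)
    moreover have "ln (1 / (1 - a)) \<le> 1 / (1 - a) - 1" using that by (intro ln_le_minus_one) auto
    moreover have "1 / (1 - a) - 1 = a / (1 - a)" using that by (simp add: field_simps)
    moreover have "a \<le> a / (1 - a)" using that by (simp add: le_divide_eq mult_left_le)
    moreover have "ln (1 - a) \<le> ln (1 + a)" using that by (intro ln_mono) auto
    ultimately show ?thesis by simp
  qed
  show ?thesis
  proof (cases "0 \<le> r")
    case True
    then show ?thesis using *[of r] assms by simp
  next
    case False
    then show ?thesis using *[of "- r"] assms by (simp add: abs_minus_commute)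
  qed
qed

text \<open>The diameter of the ball in direction \<open>v\<close>, run through affinely (a
  homography with c = 0), is an admissible geodesic. The step goes from parameter 0 to a /
  R.\<close>

lemma markowitz_reach_lightlike_step:
  assumes "lightlike v" "norm v = 1" "ball x R \<subseteq> \<Omega>" "\<bar>a\<bar> < R"
  shows "markowitz_reach \<Omega> x (x + a *\<^sub>R v) (2 * \<bar>a\<bar> / (R - \<bar>a\<bar>))"
proof -
  have R: "0 < R" using assms(4) by simp
  let ?\<gamma> = "\<lambda>s. x + ((R * s + 0) / (0 * s + 1)) *\<^sub>R v"
  have "?\<gamma> s \<in> \<Omega>" if "s \<in> {-1<..<1}" for s
  proof -
    have "\<bar>s\<bar> < 1" using that by auto
    then have "\<bar>R\<bar> * \<bar>s\<bar> < R" using R by simp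
    then have "?\<gamma> s \<in> ball x R" using assms(2) by (simp add: dist_norm abs_mult)
    then show ?thesis using assms(3) by blast
  qed
  then have "\<forall>s\<in>{-1<..<1}. 0 * s + 1 \<noteq> 0 \<and> ?\<gamma> s = x + ((R * s + 0) / (0 * s + 1)) *\<^sub>R v \<and> ?\<gamma> s \<in> \<Omega>"
    by simp
  moreover have "R * 1 - 0 * 0 \<noteq> 0" using R by simp
  ultimately have geo: "projective_lightlike_geodesic \<Omega> ?\<gamma>"
    unfolding projective_lightlike_geodesic_def using assms(1)
    by (intro exI[of _ x] exI[of _ v] exI[of _ R] exI[of _ 0] exI[of _ 1]) simp
  have r: "\<bar>a / R\<bar> < 1" using assms(4) R by (simp add: divide_less_eq)
  then have rI: "a / R \<in> {-1<..<1}" using abs_less_iff[of "a / R" 1] by auto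
  have "markowitz_chain \<Omega> x (x + a *\<^sub>R v) 1 (\<lambda>_. ?\<gamma>) (\<lambda>_. 0) (\<lambda>_. a / R)"
    unfolding markowitz_chain_def using geo rI R by simp
  moreover have "rho_I 0 (a / R) \<le> 2 * \<bar>a\<bar> / (R - \<bar>a\<bar>)"
  proof -
    have "rho_I 0 (a / R) = \<bar>ln (1 + a / R) - ln (1 - a / R)\<bar>"
      using rho_I_eq[of 0 "a / R"] rI by simp
    also have "\<dots> \<le> 2 * \<bar>a / R\<bar> / (1 - \<bar>a / R\<bar>)" by (rule abs_ln_ratio_le[OF r])
    also have "\<dots> = 2 * \<bar>a\<bar> / (R - \<bar>a\<bar>)" using R by (simp add: field_simps)
    finally show ?thesis .
  qed
  ultimately show ?thesis unfolding markowitz_reach_def by (intro exI conjI) auto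
qed

text \<open>In the plane spanned by the time axis and the spatial part of \<open>w\<close>, of
  length r, the lightlike directions (1, u) and (1, -u), divided by sqrt 2, are orthonormal. The
  coefficient bound follows from |t + r| + |t - r| = 2 max(|t|, r), where t is the time
  component.\<close>

lemma lightlike_decomposition:
  fixes w :: "'n::finite spacetime"
  obtains v\<^sub>1 v\<^sub>2 a\<^sub>1 a\<^sub>2 where "lightlike v\<^sub>1" "norm v\<^sub>1 = 1" "lightlike v\<^sub>2" "norm v\<^sub>2 = 1"
    "w = a\<^sub>1 *\<^sub>R v\<^sub>1 + a\<^sub>2 *\<^sub>R v\<^sub>2" "\<bar>a\<^sub>1\<bar> + \<bar>a\<^sub>2\<bar> \<le> sqrt 2 * norm w"
proof -
  define r where "r = norm (snd w)"
  \<comment> \<open>A substitute direction for the case of a vanishing spatial part.\<close>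
  obtain e :: "real ^ 'n" where e: "norm e = 1" using vector_choose_size[of 1] by auto
  define u where "u = (if snd w = 0 then e else snd w /\<^sub>R r)"
  have u: "norm u = 1" "snd w = r *\<^sub>R u" using e by (auto simp: u_def r_def)
  let ?v = "\<lambda>\<sigma>. (1 / sqrt 2) *\<^sub>R (1 :: real, \<sigma> *\<^sub>R u)"
  have v: "lightlike (?v \<sigma>)" "norm (?v \<sigma>) = 1" if "\<bar>\<sigma>\<bar> = 1" for \<sigma>
  proof -
    have l: "lightlike (1 :: real, \<sigma> *\<^sub>R u)" using that u(1) by (simp add: lightlike_iff zero_prod_def)
    then show "lightlike (?v \<sigma>)" by (rule lightlike_scaleR) simp
    have "norm (1 :: real, \<sigma> *\<^sub>R u) = sqrt 2" using norm_lightlike[OF l] by simp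
    then show "norm (?v \<sigma>) = 1" unfolding norm_scaleR by simp
  qed
  let ?a = "(fst w + r) / sqrt 2" and ?b = "(fst w - r) / sqrt 2"
  have "fst w = ?a * (1 / sqrt 2) + ?b * (1 / sqrt 2)" "r = ?a * (1 / sqrt 2) - ?b * (1 / sqrt 2)"
    by (simp_all add: field_simps)
  then have dec: "w = ?a *\<^sub>R ?v 1 + ?b *\<^sub>R ?v (- 1)"
    using u(2) by (simp add: prod_eq_iff scaleR_diff_left[symmetric])
  have le: "\<bar>?a\<bar> + \<bar>?b\<bar> \<le> sqrt 2 * norm w"
  proof -
    have "\<bar>fst w\<bar> \<le> norm w" "r \<le> norm w" "0 \<le> r"
      using norm_fst_le[of "fst w" "snd w"] norm_snd_le[of "snd w" "fst w"] by (simp_all add: r_def)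
    then have "\<bar>fst w + r\<bar> + \<bar>fst w - r\<bar> \<le> 2 * norm w" by linarith
    then have "(\<bar>fst w + r\<bar> + \<bar>fst w - r\<bar>) / sqrt 2 \<le> 2 * norm w / sqrt 2" by (rule divide_right_mono) simp
    moreover have "2 * norm w / sqrt 2 = sqrt 2 * norm w" by (simp add: real_div_sqrt field_simps)
    moreover have "\<bar>?a\<bar> + \<bar>?b\<bar> = (\<bar>fst w + r\<bar> + \<bar>fst w - r\<bar>) / sqrt 2"
      by (simp add: abs_divide add_divide_distrib[of "\<bar>fst w + r\<bar>"])
    ultimately show ?thesis by simp
  qed
  show ?thesis
    by (rule that[OF v(1)[of 1] v(2)[of 1] v(1)[of "- 1"] v(2)[of "- 1"] dec le]) simp_all
qed

text \<open>The second lightlike step starts off centre, in the ball of radius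
  \<open>R - \<bar>a\<^sub>1\<bar>\<close> that remains. Both denominators are at least
  \<open>R - sqrt 2 * norm w\<close>, which tends to \<open>R\<close> for short
  \<open>w\<close>.\<close>

lemma markowitz_reach_ball:
  assumes ball: "ball x R \<subseteq> \<Omega>" and w: "sqrt 2 * norm w < R"
  shows "markowitz_reach \<Omega> x (x + w) (2 * sqrt 2 * norm w / (R - sqrt 2 * norm w))"
proof -
  obtain v\<^sub>1 v\<^sub>2 a\<^sub>1 a\<^sub>2 where v: "lightlike v\<^sub>1" "norm v\<^sub>1 = 1" "lightlike v\<^sub>2" "norm v\<^sub>2 = 1"
    and dec: "w = a\<^sub>1 *\<^sub>R v\<^sub>1 + a\<^sub>2 *\<^sub>R v\<^sub>2" and le: "\<bar>a\<^sub>1\<bar> + \<bar>a\<^sub>2\<bar> \<le> sqrt 2 * norm w"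
    using lightlike_decomposition[of w] .
  have 1: "markowitz_reach \<Omega> x (x + a\<^sub>1 *\<^sub>R v\<^sub>1) (2 * \<bar>a\<^sub>1\<bar> / (R - \<bar>a\<^sub>1\<bar>))"
    using le w by (intro markowitz_reach_lightlike_step v ball) auto
  have "ball (x + a\<^sub>1 *\<^sub>R v\<^sub>1) (R - \<bar>a\<^sub>1\<bar>) \<subseteq> ball x R"
  proof
    fix z assume "z \<in> ball (x + a\<^sub>1 *\<^sub>R v\<^sub>1) (R - \<bar>a\<^sub>1\<bar>)"
    then show "z \<in> ball x R"
      using dist_triangle[of x z "x + a\<^sub>1 *\<^sub>R v\<^sub>1"] v(2) by (simp add: dist_norm)
  qed
  then have 2: "markowitz_reach \<Omega> (x + a\<^sub>1 *\<^sub>R v\<^sub>1) (x + a\<^sub>1 *\<^sub>R v\<^sub>1 + a\<^sub>2 *\<^sub>R v\<^sub>2)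
      (2 * \<bar>a\<^sub>2\<bar> / (R - \<bar>a\<^sub>1\<bar> - \<bar>a\<^sub>2\<bar>))"
    using le w ball by (intro markowitz_reach_lightlike_step v) auto
  have "2 * \<bar>a\<^sub>1\<bar> / (R - \<bar>a\<^sub>1\<bar>) \<le> 2 * \<bar>a\<^sub>1\<bar> / (R - sqrt 2 * norm w)"
    "2 * \<bar>a\<^sub>2\<bar> / (R - \<bar>a\<^sub>1\<bar> - \<bar>a\<^sub>2\<bar>) \<le> 2 * \<bar>a\<^sub>2\<bar> / (R - sqrt 2 * norm w)"
    using le w by (auto intro!: divide_left_mono mult_pos_pos)
  then have "2 * \<bar>a\<^sub>1\<bar> / (R - \<bar>a\<^sub>1\<bar>) + 2 * \<bar>a\<^sub>2\<bar> / (R - \<bar>a\<^sub>1\<bar> - \<bar>a\<^sub>2\<bar>)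
      \<le> 2 * (\<bar>a\<^sub>1\<bar> + \<bar>a\<^sub>2\<bar>) / (R - sqrt 2 * norm w)"
    by (simp add: add_divide_distrib distrib_left)
  also have "\<dots> \<le> 2 * sqrt 2 * norm w / (R - sqrt 2 * norm w)"
    using le w by (intro divide_right_mono) auto
  finally show ?thesis
    using markowitz_reach_mono[OF markowitz_reach_trans[OF 1 2]] by (simp add: dec add.assoc)
qed

text \<open>The estimate for a short chord differs from the integrand by a relative error, since the
  distance to the frontier varies and the chord eats into the ball. This error tends to 0 with the
  length of the chord, so any factor above 1 absorbs it.\<close>

lemma markowitz_reach_curve:
  assumes dom: "domain \<Omega>" and \<gamma>: "piecewise_smooth_curve \<gamma>" "\<gamma> ` {0..1} \<subseteq> \<Omega>" and \<kappa>: "1 < \<kappa>"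
  shows "markowitz_reach \<Omega> (\<gamma> 0) (\<gamma> 1) (\<kappa> * (2 * sqrt 2 * quasihyperbolic_length \<Omega> \<gamma>))"
proof -
  define g where "g = (\<lambda>t. norm (vector_derivative \<gamma> (at t within {0..1})))"
  define \<delta> where "\<delta> = (\<lambda>t. infdist (\<gamma> t) (frontier \<Omega>))"
  define J where "J = (\<lambda>a b. integral {a..b} (\<lambda>t. g t / \<delta> t))"
  have int: "(\<lambda>t. g t / \<delta> t) integrable_on {0..1}"
    unfolding g_def \<delta>_def by (rule quasihyperbolic_integrable[OF dom \<gamma>])
  have intg: "g integrable_on {0..1}"
    using piecewise_smooth_curve_integrable[OF \<gamma>(1), of "\<lambda>_. 1"] by (simp add: g_def)
  have \<delta>_pos: "0 < \<delta> t" if "t \<in> {0..1}" for t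
    unfolding \<delta>_def using infdist_frontier_pos[OF dom] \<gamma>(2) that by blast
  \<comment> \<open>The property is additive on adjacent intervals and, thanks to the slack \<open>\<kappa>\<close>, holds on short ones;
      Bolzano's bisection lemma extends it to the unit interval.\<close>
  have "0 \<le> a \<and> b \<le> 1 \<longrightarrow> markowitz_reach \<Omega> (\<gamma> a) (\<gamma> b) (\<kappa> * (2 * sqrt 2 * J a b))"
    if "a = 0" "b = 1" for a b :: real
  proof (rule Bolzano[of a b])
    show "a \<le> b" using that by simp
  next
    fix a b c :: real
    assume ab: "0 \<le> a \<and> b \<le> 1 \<longrightarrow> markowitz_reach \<Omega> (\<gamma> a) (\<gamma> b) (\<kappa> * (2 * sqrt 2 * J a b))"
      and bc: "0 \<le> b \<and> c \<le> 1 \<longrightarrow> markowitz_reach \<Omega> (\<gamma> b) (\<gamma> c) (\<kappa> * (2 * sqrt 2 * J b c))"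
      and le: "a \<le> b" "b \<le> c"
    show "0 \<le> a \<and> c \<le> 1 \<longrightarrow> markowitz_reach \<Omega> (\<gamma> a) (\<gamma> c) (\<kappa> * (2 * sqrt 2 * J a c))"
    proof
      assume ac: "0 \<le> a \<and> c \<le> 1"
      have "(\<lambda>t. g t / \<delta> t) integrable_on {a..c}"
        by (rule integrable_on_subinterval[OF int]) (use ac in auto)
      then have "J a b + J b c = J a c"
        unfolding J_def using le by (intro Henstock_Kurzweil_Integration.integral_combine) auto
      then have "\<kappa> * (2 * sqrt 2 * J a b) + \<kappa> * (2 * sqrt 2 * J b c) = \<kappa> * (2 * sqrt 2 * J a c)"
        by (simp only: distrib_left[symmetric])
      moreover have "markowitz_reach \<Omega> (\<gamma> a) (\<gamma> c) (\<kappa> * (2 * sqrt 2 * J a b) + \<kappa> * (2 * sqrt 2 * J b c))"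
        using ab bc ac le by (intro markowitz_reach_trans[of _ _ "\<gamma> b"]) auto
      ultimately show "markowitz_reach \<Omega> (\<gamma> a) (\<gamma> c) (\<kappa> * (2 * sqrt 2 * J a c))" by simp
    qed
  next
    fix x assume "a \<le> x" "x \<le> b"
    then have x: "x \<in> {0..1}" using that by simp
    \<comment> \<open>Solves (\<open>\<delta> x\<close> + \<zeta>) / (\<open>\<delta> x\<close> -
      \<zeta>) = \<kappa>. The chord estimate will divide by at least
      \<open>\<delta> x - \<zeta>\<close>, the integrand by at most
      \<open>\<delta> x + \<zeta>\<close>.\<close>
    define \<zeta> where "\<zeta> = \<delta> x * (\<kappa> - 1) / (\<kappa> + 1)"
    have \<zeta>: "0 < \<zeta>" "\<zeta> < \<delta> x" "\<delta> x + \<zeta> = \<kappa> * (\<delta> x - \<zeta>)"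
      using \<kappa> \<delta>_pos[OF x] by (simp_all add: \<zeta>_def field_simps)
    \<comment> \<open>With \<zeta> / 8, the chord has r \<le> \<zeta> / 4, so sqrt 2 r \<le> \<zeta>
      / 2; adding the \<zeta> / 8 by which \<delta> may drop keeps the loss below \<zeta>.\<close>
    obtain d where d: "0 < d" "\<And>t. t \<in> {0..1} \<Longrightarrow> dist t x < d \<Longrightarrow> dist (\<gamma> t) (\<gamma> x) < \<zeta> / 8"
      using piecewise_smooth_curve_continuous[OF \<gamma>(1)] x \<zeta>(1) unfolding continuous_on_iff
      by (metis zero_less_divide_iff zero_less_numeral)
    \<comment> \<open>The local clause ranges over all small intervals around \<open>x\<close>, even
      those leaving [0, 1]; the premise inside the property excludes the latter.\<close>
    show "\<exists>d>0. \<forall>a b. a \<le> x \<and> x \<le> b \<and> b - a < d \<longrightarrow>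
        0 \<le> a \<and> b \<le> 1 \<longrightarrow> markowitz_reach \<Omega> (\<gamma> a) (\<gamma> b) (\<kappa> * (2 * sqrt 2 * J a b))"
    proof (intro exI[of _ d] conjI allI impI d(1))
      fix a b assume 1: "a \<le> x \<and> x \<le> b \<and> b - a < d" and 2: "0 \<le> a \<and> b \<le> 1"
      define r where "r = norm (\<gamma> b - \<gamma> a)"
      have near: "dist (\<gamma> t) (\<gamma> x) < \<zeta> / 8" if "t \<in> {a..b}" for t
        using that 1 2 by (intro d(2)) (auto simp: dist_real_def)
      have \<delta>_near: "\<bar>\<delta> t - \<delta> x\<bar> \<le> \<zeta> / 8" if "t \<in> {a..b}" for t
        using near[OF that] infdist_triangle_abs[of "\<gamma> t" "frontier \<Omega>" "\<gamma> x"] unfolding \<delta>_def by linarith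
      have "r \<le> \<zeta> / 4"
        using near[of a] near[of b] 1 dist_triangle2[of "\<gamma> b" "\<gamma> a" "\<gamma> x"]
        unfolding r_def dist_norm by auto
      moreover have "sqrt 2 * r \<le> 2 * r"
        by (intro mult_right_mono) (auto simp: r_def real_le_lsqrt)
      moreover have "\<bar>\<delta> a - \<delta> x\<bar> \<le> \<zeta> / 8" using 1 by (intro \<delta>_near) auto
      ultimately have room: "\<delta> x - \<zeta> \<le> \<delta> a - sqrt 2 * r"
        using \<zeta>(1) by linarith
      have "ball (\<gamma> a) (\<delta> a) \<subseteq> \<Omega>"
        unfolding \<delta>_def using \<gamma>(2) 1 2 by (intro infdist_frontier_ball_subset[OF dom]) auto
      then have reach: "markowitz_reach \<Omega> (\<gamma> a) (\<gamma> b) (2 * sqrt 2 * r / (\<delta> a - sqrt 2 * r))"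
        using markowitz_reach_ball[of "\<gamma> a" "\<delta> a" \<Omega> "\<gamma> b - \<gamma> a"] room \<zeta>(2) unfolding r_def by simp
      have sub: "(\<lambda>t. g t / \<delta> t) integrable_on {a..b}" "g integrable_on {a..b}"
        using integrable_on_subinterval[OF int] integrable_on_subinterval[OF intg] 1 2 by auto
      have "r \<le> integral {a..b} g"
        unfolding r_def g_def using 1 2 by (intro piecewise_smooth_curve_norm_diff_le[OF \<gamma>(1)]) auto
      then have "r / (\<delta> x + \<zeta>) \<le> integral {a..b} g / (\<delta> x + \<zeta>)"
        using \<zeta>(1,2) by (intro divide_right_mono) auto
      also have "\<dots> = integral {a..b} (\<lambda>t. g t / (\<delta> x + \<zeta>))"
        by (simp add: integral_divide)
      also have "\<dots> \<le> J a b"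
        unfolding J_def
      proof (rule integral_le[OF _ sub(1)])
        show "(\<lambda>t. g t / (\<delta> x + \<zeta>)) integrable_on {a..b}"
          using integrable_on_divide[OF sub(2)] .
        fix t assume t: "t \<in> {a..b}"
        have "\<delta> t \<le> \<delta> x + \<zeta>" using \<delta>_near[OF t] \<zeta>(1) by linarith
        moreover have "0 < \<delta> t" using t 1 2 by (intro \<delta>_pos) auto
        ultimately show "g t / (\<delta> x + \<zeta>) \<le> g t / \<delta> t"
          by (intro divide_left_mono) (auto simp: g_def)
      qed
      finally have Jr: "r / (\<delta> x + \<zeta>) \<le> J a b" .
      have "2 * sqrt 2 * r / (\<delta> a - sqrt 2 * r) \<le> 2 * sqrt 2 * r / (\<delta> x - \<zeta>)"
        using room \<zeta>(2) by (intro divide_left_mono) (auto simp: r_def)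
      also have "\<dots> = \<kappa> * (2 * sqrt 2 * (r / (\<delta> x + \<zeta>)))"
        using \<kappa> \<zeta>(2) unfolding \<zeta>(3) by simp
      also have "\<dots> \<le> \<kappa> * (2 * sqrt 2 * J a b)"
        using Jr \<kappa> by (intro mult_left_mono) auto
      finally show "markowitz_reach \<Omega> (\<gamma> a) (\<gamma> b) (\<kappa> * (2 * sqrt 2 * J a b))"
        using markowitz_reach_mono[OF reach] by blast
    qed
  qed
  from this[of 0 1] show ?thesis
    by (simp add: J_def g_def \<delta>_def quasihyperbolic_length_def)
qed

lemma markowitz_dist_le_quasihyperbolic_length:
  assumes dom: "domain \<Omega>" and \<gamma>: "piecewise_smooth_curve \<gamma>" "\<gamma> ` {0..1} \<subseteq> \<Omega>"
  shows "markowitz_dist \<Omega> (\<gamma> 0) (\<gamma> 1) \<le> ennreal (2 * sqrt 2) * ennreal (quasihyperbolic_length \<Omega> \<gamma>)"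
proof -
  let ?L = "2 * sqrt 2 * quasihyperbolic_length \<Omega> \<gamma>"
  have "0 \<le> quasihyperbolic_length \<Omega> \<gamma>"
    unfolding quasihyperbolic_length_def by (rule integral_nonneg[OF quasihyperbolic_integrable[OF assms]])
      (simp add: infdist_nonneg)
  then have L: "0 \<le> ?L" by simp
  have le: "markowitz_dist \<Omega> (\<gamma> 0) (\<gamma> 1) \<le> ennreal (\<kappa> * ?L)" if "1 < \<kappa>" for \<kappa>
    using markowitz_dist_le[OF markowitz_reach_curve[OF assms that]] .
  \<comment> \<open>The slack is removed by letting \<kappa> decrease to 1, which is where the sharp
    factor 2 sqrt 2 reappears.\<close>
  have "((\<lambda>\<kappa>. ennreal (\<kappa> * ?L)) \<longlongrightarrow> ennreal (1 * ?L)) (at_right 1)"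
    by (intro tendsto_ennrealI tendsto_intros)
  moreover have "\<forall>\<^sub>F \<kappa> in at_right 1. markowitz_dist \<Omega> (\<gamma> 0) (\<gamma> 1) \<le> ennreal (\<kappa> * ?L)"
    by (rule eventually_mono[OF eventually_at_right_less]) (rule le)
  ultimately have "markowitz_dist \<Omega> (\<gamma> 0) (\<gamma> 1) \<le> ennreal (1 * ?L)"
    by (rule tendsto_lowerbound) (rule trivial_limit_at_right_real)
  also have "\<dots> = ennreal (2 * sqrt 2) * ennreal (quasihyperbolic_length \<Omega> \<gamma>)"
    unfolding mult_1 by (rule ennreal_mult') simp
  finally show ?thesis .
qed

lemma markowitz_dist_le_quasihyperbolic_dist:
  assumes "domain \<Omega>"
  shows "markowitz_dist \<Omega> x y \<le> ennreal (2 * sqrt 2) * quasihyperbolic_dist \<Omega> x y"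
proof -
  let ?c = "2 * sqrt 2" and ?c' = "1 / (2 * sqrt 2)"
  have inv: "ennreal ?c' * ennreal ?c = 1" "ennreal ?c * ennreal ?c' = 1"
    by (simp_all flip: ennreal_mult' ennreal_1)
  \<comment> \<open>The constant is moved to the left so that the right side is a bare infimum;
    afterwards it is multiplied back.\<close>
  have "ennreal ?c' * markowitz_dist \<Omega> x y \<le> quasihyperbolic_dist \<Omega> x y"
    unfolding quasihyperbolic_dist_def
  proof (rule INF_greatest)
    fix \<gamma> assume "\<gamma> \<in> {\<gamma>. piecewise_smooth_curve \<gamma> \<and> \<gamma> ` {0..1} \<subseteq> \<Omega> \<and> \<gamma> 0 = x \<and> \<gamma> 1 = y}"
    then have "markowitz_dist \<Omega> x y \<le> ennreal ?c * ennreal (quasihyperbolic_length \<Omega> \<gamma>)"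
      using markowitz_dist_le_quasihyperbolic_length[OF assms, of \<gamma>] by auto
    then have "ennreal ?c' * markowitz_dist \<Omega> x y
        \<le> ennreal ?c' * (ennreal ?c * ennreal (quasihyperbolic_length \<Omega> \<gamma>))"
      by (rule mult_left_mono) simp
    also have "\<dots> = ennreal (quasihyperbolic_length \<Omega> \<gamma>)"
      by (simp only: mult.assoc[symmetric] inv mult_1)
    finally show "ennreal ?c' * markowitz_dist \<Omega> x y \<le> ennreal (quasihyperbolic_length \<Omega> \<gamma>)" .
  qed
  then have "ennreal ?c * (ennreal ?c' * markowitz_dist \<Omega> x y) \<le> ennreal ?c * quasihyperbolic_dist \<Omega> x y"
    by (rule mult_left_mono) simp
  then show ?thesis by (simp only: mult.assoc[symmetric] inv mult_1)
qed

theorem theorem4p1: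
  fixes \<Omega> :: "(real \<times> (real ^ 'n::finite)) set" and \<epsilon> :: real
  assumes "domain \<Omega>"
    and "causally_convex \<Omega>"
    and "\<epsilon> > 0"
    and "stably_acausal \<epsilon> (future_causal_boundary \<Omega>)"
    and "stably_acausal \<epsilon> (past_causal_boundary \<Omega>)"
  shows "\<forall>x\<in>\<Omega>. \<forall>y\<in>\<Omega>.
      ennreal (\<epsilon> / sqrt ((2 + \<epsilon>)\<^sup>2 + \<epsilon>\<^sup>2)) * quasihyperbolic_dist \<Omega> x y \<le> markowitz_dist \<Omega> x y \<and>
      markowitz_dist \<Omega> x y \<le> ennreal (2 * sqrt 2) * quasihyperbolic_dist \<Omega> x y"
proof (intro ballI conjI)
  fix x y
  interpret stably_acausal_domain \<Omega> \<epsilon> using assms by unfold_locales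
  show "ennreal (\<epsilon> / sqrt ((2 + \<epsilon>)\<^sup>2 + \<epsilon>\<^sup>2)) * quasihyperbolic_dist \<Omega> x y \<le> markowitz_dist \<Omega> x y"
    by (rule quasihyperbolic_dist_le_markowitz_dist)
  show "markowitz_dist \<Omega> x y \<le> ennreal (2 * sqrt 2) * quasihyperbolic_dist \<Omega> x y"
    by (rule markowitz_dist_le_quasihyperbolic_dist[OF assms(1)])
qed

end
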